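(* Let $k,d$ be positive integers and let $\lambda=(\lambda_1,\ldots,\lambda_\ell)$ and $\mu=(\mu_1,\ldots,\mu_\iota)$ be $k$-bounded partitions of $d$. Then the $k$-Kostka number $K^{(k)}_{\lambda,\mu}$ is nonzero if and only if $\mu\trianglelefteq\lambda$.
   Context: Partitions are Young diagrams in French notation (row $i$ counted bottom to top). A partition is $k$-bounded if its largest part is at most $k$. Hook length of a cell: number of cells directly to its right in its row or directly above it in its column, counting the cell once; a $(k+1)$-core is a partition with no cell of hook length $k+1$. The $(k+1)$-residue of cell $(i,j)$ is $j-i\bmod(k+1)$. $\mathfrak{c}(\lambda)$ denotes the unique $(k+1)$-core $\gamma$ such that, for every $i$, row $i$ of $\gamma$ has exactly $\lambda_i$ cells of hook length at most $k$ (Lapointe–Morse bijection between $k$-bounded partitions and $(k+1)$-cores). For a composition $\alpha$ of $d$, a semistandard $k$-tableau of shape $\mathfrak{c}(\lambda)$ and $k$-weight $\alpha$ is a semistandard Young tableau of shape $\mathfrak{c}(\lambda)$ (rows weakly increasing left to right, columns strictly increasing bottom to top) such that, for each $i$, the cells filled with $i$ have exactly $\alpha_i$ distinct $(k+1)$-residues. $K^{(k)}_{\lambda,\alpha}$ is the number of such tableaux. Dominance order: $\mu\trianglelefteq\lambda$ iff $\mu_1+\cdots+\mu_i\le\lambda_1+\cdots+\lambda_i$ for all $i$. *)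

theory Defs
  imports Main "HOL-Library.FuncSet"
begin

text \<open>
  A partition is the list of its (positive) parts. Rows, columns, parts and tableau entries are
  numbered from 1, and \<open>part la i\<close> is 0 when \<open>i\<close> exceeds the number of parts.
\<close>

definition is_partition :: "nat list \<Rightarrow> bool" where
  "is_partition la \<longleftrightarrow> sorted_wrt (\<ge>) la \<and> (\<forall>p \<in> set la. 0 < p)"

definition is_partition_of :: "nat \<Rightarrow> nat list \<Rightarrow> bool" where
  "is_partition_of d la \<longleftrightarrow> is_partition la \<and> sum_list la = d"

definition k_bounded :: "nat \<Rightarrow> nat list \<Rightarrow> bool" where
  "k_bounded k la \<longleftrightarrow> (\<forall>p \<in> set la. p \<le> k)"

definition part :: "nat list \<Rightarrow> nat \<Rightarrow> nat" where
  "part la i = (if 1 \<le> i \<and> i \<le> length la then la ! (i - 1) else 0)"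

text \<open>
  French notation: the cell \<open>(i, j)\<close> lies in row \<open>i\<close>, counted from bottom to top, and column \<open>j\<close>,
  counted from left to right, so a cell above \<open>(i, j)\<close> has a larger first coordinate.
\<close>

definition cells :: "nat list \<Rightarrow> (nat \<times> nat) set" where
  "cells la = {(i, j). 1 \<le> i \<and> i \<le> length la \<and> 1 \<le> j \<and> j \<le> part la i}"

definition hook :: "nat list \<Rightarrow> nat \<times> nat \<Rightarrow> (nat \<times> nat) set" where
  "hook la = (\<lambda>(i, j). {(i', j') \<in> cells la. (i' = i \<and> j \<le> j') \<or> (j' = j \<and> i \<le> i')})"

definition hook_length :: "nat list \<Rightarrow> nat \<times> nat \<Rightarrow> nat" where
  "hook_length la c = card (hook la c)"

definition is_core :: "nat \<Rightarrow> nat list \<Rightarrow> bool" where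
  "is_core n ga \<longleftrightarrow> is_partition ga \<and> (\<forall>c \<in> cells ga. hook_length ga c \<noteq> n)"

definition residue :: "nat \<Rightarrow> nat \<times> nat \<Rightarrow> int" where
  "residue n = (\<lambda>(i, j). (int j - int i) mod int n)"

definition core_of :: "nat \<Rightarrow> nat list \<Rightarrow> nat list" where
  "core_of k la = (THE ga. is_core (k + 1) ga \<and>
     (\<forall>i\<ge>1. card {j. (i, j) \<in> cells ga \<and> hook_length ga (i, j) \<le> k} = part la i))"

text \<open>
  A filling is a function that is \<open>undefined\<close> outside the shape, so that distinct functions are
  distinct tableaux.
\<close>

definition semistandard_tableaux :: "nat list \<Rightarrow> (nat \<times> nat \<Rightarrow> nat) set" where
  "semistandard_tableaux sh = {T \<in> cells sh \<rightarrow>\<^sub>E {1..}.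
     (\<forall>i j j'. (i, j) \<in> cells sh \<and> (i, j') \<in> cells sh \<and> j < j' \<longrightarrow> T (i, j) \<le> T (i, j')) \<and>
     (\<forall>i i' j. (i, j) \<in> cells sh \<and> (i', j) \<in> cells sh \<and> i < i' \<longrightarrow> T (i, j) < T (i', j))}"

text \<open>
  The weight condition ranges over all \<open>i\<close>; beyond the length of \<open>al\<close> it says that no cell is
  filled with \<open>i\<close>.
\<close>

definition k_tableaux :: "nat \<Rightarrow> nat list \<Rightarrow> nat list \<Rightarrow> (nat \<times> nat \<Rightarrow> nat) set" where
  "k_tableaux k la al = {T \<in> semistandard_tableaux (core_of k la).
     \<forall>i\<ge>1. card (residue (k + 1) ` {c \<in> cells (core_of k la). T c = i}) = part al i}"

definition k_Kostka :: "nat \<Rightarrow> nat list \<Rightarrow> nat list \<Rightarrow> nat" where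
  "k_Kostka k la al = card (k_tableaux k la al)"

definition dominated_by :: "nat list \<Rightarrow> nat list \<Rightarrow> bool" where
  "dominated_by mu la \<longleftrightarrow> (\<forall>i. (\<Sum>j = 1..i. part mu j) \<le> (\<Sum>j = 1..i. part la j))"

lemma finite_cells: "finite (cells la)"
proof (rule finite_subset)
  show "cells la \<subseteq> (SIGMA i:{1..length la}. {1..part la i})"
    by (auto simp: cells_def)
qed simp

lemma finite_k_tableaux: "finite (k_tableaux k la al)"
proof (rule finite_subset)
  let ?D = "cells (core_of k la)"
  show "k_tableaux k la al \<subseteq> ?D \<rightarrow>\<^sub>E {1..length al}"
  proof
    fix T assume T: "T \<in> k_tableaux k la al"
    then have ext: "T \<in> ?D \<rightarrow>\<^sub>E {1..}"
      and wt: "\<And>i. i \<ge> 1 \<Longrightarrow> card (residue (k + 1) ` {c \<in> ?D. T c = i}) = part al i"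
      by (simp_all add: k_tableaux_def semistandard_tableaux_def)
    have "T c \<in> {1..length al}" if c: "c \<in> ?D" for c
    proof (rule ccontr)
      assume "T c \<notin> {1..length al}"
      moreover have pos: "T c \<ge> 1" using PiE_mem[OF ext c] by simp
      ultimately have "part al (T c) = 0" by (simp add: part_def)
      then have "card (residue (k + 1) ` {c' \<in> ?D. T c' = T c}) = 0" using wt[OF pos] by simp
      then have "{c' \<in> ?D. T c' = T c} = {}" using finite_cells by simp
      then show False using c by blast
    qed
    then show "T \<in> ?D \<rightarrow>\<^sub>E {1..length al}" using ext by (auto simp: PiE_iff)
  qed
qed (simp add: finite_PiE finite_cells)

end

theory Submission
  imports Defs
begin

text \<open>
  Encode a shape by its beads, the contents of the last cells of its rows; for \<open>n = k + 1\<close>, the shape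
  is an \<open>n\<close>-core iff its set of beads is closed under subtracting \<open>n\<close>. The cells of hook length at
  most \<open>k\<close> are the inversions: a bead \<open>b\<close> and a non-bead \<open>c\<close> with \<open>c < b < c + n\<close>.

  If a tableau exists, then dominance follows from a bound: in any semistandard tableau on a core, the
  numbers of residues of the letters add up to at least the number of inversions. Indeed, removing
  all removable cells of one residue from a core swaps two residue classes of beads, which gives a core
  with at most one inversion less; a horizontal strip can be removed residue by residue, as it misses
  some residue. Apply this to the rows above row \<open>i\<close>, whose entries exceed \<open>i\<close>.

  Conversely, let \<open>m\<close> be the last part of \<open>mu\<close> and choose adjacent parts \<open>q \<le> m \<le> p\<close> of \<open>la\<close>.
  Replacing \<open>p, q\<close> by the single part \<open>p + q - m\<close> preserves dominance, and the two cores differ by a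
  horizontal strip with at most \<open>m\<close> residues. Iterating gives a tableau with at most \<open>mu\<^sub>i\<close> residues of
  letter \<open>i\<close>, and the bound above forces equality.
\<close>

section \<open>Beads, cores and removal of cells of one residue\<close>

text \<open>Deleting the largest letter from a semistandard tableau on a core need not leave a core.
  The bound is therefore proved for arbitrary semistandard fillings of cores: the remaining shape is
  replaced by a core inside it, and restricting the filling to that core can only lose residues.
  Inequalities suffice throughout.

  Dominance results from comparing tails: the core of the parts after the \<open>i\<close>-th has as
  many inversions as their sum, and the letters available in its rows all exceed \<open>i\<close>.
  As both partitions have the same sum, tails and initial sums carry the same information.

  The value \<open>p + q - m\<close> comes from a count. If \<open>t\<close> is the merged part,
  then all but \<open>p + q - t\<close> of the \<open>n\<close> runners are rotated cyclically, and
  the strip between the two cores has only residues of runners that stay in place;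
  \<open>p + q - t = m\<close> determines \<open>t\<close>. Once \<open>la\<close> and
  \<open>mu\<close> have equal length, dominance puts \<open>m\<close> between the last and the
  first part of \<open>la\<close>, so adjacent parts around \<open>m\<close> exist. Each merge uses
  up one part, hence the padding of \<open>la\<close> by zeros.\<close>

definition bead :: "(nat \<Rightarrow> nat) \<Rightarrow> nat \<Rightarrow> int" where
  "bead g i = int (g i) - int i - 1"

text \<open>Rows are counted from 0 and continue forever: the empty row \<open>i\<close> contributes
  the bead \<open>- i - 1\<close>, so that all sufficiently negative integers are beads. This is the
  Maya diagram of the shape.\<close>

definition beads :: "(nat \<Rightarrow> nat) \<Rightarrow> int set" where
  "beads g = range (bead g)"

definition young_shape :: "(nat \<Rightarrow> nat) \<Rightarrow> bool" where
  "young_shape g \<longleftrightarrow> antimono g \<and> (\<exists>L. \<forall>i\<ge>L. g i = 0)"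

definition core_set :: "nat \<Rightarrow> int set \<Rightarrow> bool" where
  "core_set n B \<longleftrightarrow> (\<forall>b\<in>B. b - int n \<in> B)"

definition inversions :: "nat \<Rightarrow> int set \<Rightarrow> (int \<times> int) set" where
  "inversions n B = {(b, c). b \<in> B \<and> c \<notin> B \<and> c < b \<and> b < c + int n}"

lemma bead_less: "antimono g \<Longrightarrow> i < j \<Longrightarrow> bead g j < bead g i"
  unfolding bead_def using antimonoD[of g i j] by simp

lemma bead_less_iff: "antimono g \<Longrightarrow> bead g i < bead g j \<longleftrightarrow> j < i"
  by (metis bead_less linorder_neqE_nat order_less_asym)

lemma bead_le_iff: "antimono g \<Longrightarrow> bead g i \<le> bead g j \<longleftrightarrow> j \<le> i"
  by (metis bead_less_iff linorder_not_less)

lemma inj_bead: "antimono g \<Longrightarrow> inj (bead g)"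
  by (rule injI) (metis bead_less_iff linorder_neqE_nat less_irrefl)

lemma beads_low:
  assumes "\<forall>i\<ge>L. g i = 0" "x < - int L"
  shows "x \<in> beads g"
proof -
  have "x = bead g (nat (- x - 1))" using assms by (simp add: bead_def)
  then show ?thesis unfolding beads_def by blast
qed

text \<open>Removing the last cell of a row lowers its bead by one; the cell is removable exactly if
  that place is free.\<close>

lemma bead_pred_notin:
  assumes "antimono g"
  shows "bead g i - 1 \<notin> beads g \<longleftrightarrow> g (Suc i) < g i"
proof
  assume "bead g i - 1 \<notin> beads g"
  then have "bead g (Suc i) \<noteq> bead g i - 1" unfolding beads_def by (metis rangeI)
  then show "g (Suc i) < g i"
    using antimonoD[OF assms, of i "Suc i"] by (auto simp: bead_def)
next
  assume less: "g (Suc i) < g i"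
  show "bead g i - 1 \<notin> beads g"
  proof
    assume "bead g i - 1 \<in> beads g"
    then obtain l where l: "bead g l = bead g i - 1" unfolding beads_def by force
    then have "i < l" using bead_less_iff[OF assms, of l i] by simp
    then have "bead g l \<le> bead g (Suc i)" using bead_le_iff[OF assms] by simp
    then show False using l less by (simp add: bead_def)
  qed
qed

text \<open>The number is the content of the cell just above the top cell of column
  \<open>j\<close>. It lies strictly between the beads of the consecutive rows \<open>Suc i\<close>
  and \<open>i\<close>.\<close>

lemma column_top_gap:
  assumes "antimono g" "g (Suc i) \<le> j" "j < g i"
  shows "int j - int i - 1 \<notin> beads g"
proof
  assume "int j - int i - 1 \<in> beads g"
  then obtain l where l: "bead g l = int j - int i - 1" unfolding beads_def by force
  have "bead g (Suc i) < bead g l" "bead g l < bead g i"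
    using assms l by (auto simp: bead_def)
  then show False using bead_less_iff[OF assms(1)] by simp
qed

lemma core_set_down:
  assumes "core_set n B" "b \<in> B" "x \<le> b" "int n dvd b - x"
  shows "x \<in> B"
proof (cases "n = 0")
  case True
  then show ?thesis using assms by simp
next
  case False
  obtain q where q: "b - x = int n * q" using assms(4) by auto
  have "q \<ge> 0" using q assms(3) False by (metis diff_ge_0_iff_ge of_nat_0_less_iff
        zero_le_mult_iff gr0I linorder_not_less)
  have "b - int n * int m \<in> B" for m
  proof (induction m)
    case (Suc m)
    then have "b - int n * int m - int n \<in> B" using assms(1) by (simp add: core_set_def)
    then show ?case by (simp add: algebra_simps)
  qed (use assms in simp)
  from this[of "nat q"] have "b - int n * q \<in> B" using \<open>q \<ge> 0\<close> by simp
  moreover have "x = b - int n * q" using q by simp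
  ultimately show ?thesis by simp
qed

lemma finite_inversions:
  assumes "young_shape g"
  shows "finite (inversions n (beads g))"
proof -
  obtain L where L: "\<forall>i\<ge>L. g i = 0" using assms by (auto simp: young_shape_def)
  have anti: "antimono g" using assms by (simp add: young_shape_def)
  have "inversions n (beads g) \<subseteq> {- int L..bead g 0} \<times> {- int L..bead g 0}"
  proof
    fix z assume "z \<in> inversions n (beads g)"
    then obtain b c where z: "z = (b, c)" "b \<in> beads g" "c \<notin> beads g" "c < b"
      by (auto simp: inversions_def)
    have "- int L \<le> c" using beads_low[OF L, of c] z(3) by force
    moreover have "b \<le> bead g 0" using z(2) bead_le_iff[OF anti] by (auto simp: beads_def)
    ultimately show "z \<in> {- int L..bead g 0} \<times> {- int L..bead g 0}" using z by auto
  qed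
  then show ?thesis by (rule finite_subset) simp
qed

section \<open>Removing all removable cells of one residue\<close>

definition swap_residues :: "nat \<Rightarrow> int \<Rightarrow> int \<Rightarrow> int" where
  "swap_residues n r x =
     (if int n dvd x - r then x - 1 else if int n dvd x + 1 - r then x + 1 else x)"

definition remove_cells :: "nat \<Rightarrow> int \<Rightarrow> (nat \<Rightarrow> nat) \<Rightarrow> nat \<Rightarrow> nat" where
  "remove_cells n r g i = (if int n dvd bead g i - r \<and> g (Suc i) < g i then g i - 1 else g i)"

lemma dvd_one_step:
  assumes "2 \<le> n" "int n dvd x" shows "\<not> int n dvd x + 1" "\<not> int n dvd x - 1"
proof -
  have "\<not> int n dvd 1" using assms(1) by simp
  then show "\<not> int n dvd x + 1" "\<not> int n dvd x - 1"
    using assms(2) by (metis dvd_add_right_iff, metis dvd_diff_right_iff)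
qed

lemma swap_residues_swap_residues:
  "2 \<le> n \<Longrightarrow> swap_residues n r (swap_residues n r x) = x"
  using dvd_one_step[of n "x - r"] dvd_one_step[of n "x + 1 - r"]
  by (auto simp: swap_residues_def algebra_simps)

lemma swap_residues_minus: "swap_residues n r (x - int n) = swap_residues n r x - int n"
proof -
  have "int n dvd x - int n - r \<longleftrightarrow> int n dvd x - r"
    by (metis diff_right_commute dvd_diff_commute dvd_diff_right_iff dvd_refl)
  moreover have "int n dvd x - int n + 1 - r \<longleftrightarrow> int n dvd x + 1 - r"
    by (smt (verit) dvd_diff_right_iff dvd_refl dvd_diff_commute)
  ultimately show ?thesis by (simp add: swap_residues_def)
qed

lemma remove_cells_le: "remove_cells n r g i \<le> g i"
  by (simp add: remove_cells_def)

lemma young_shape_remove_cells: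
  assumes "young_shape g" shows "young_shape (remove_cells n r g)"
proof -
  have anti: "antimono g" using assms by (simp add: young_shape_def)
  have "remove_cells n r g (Suc i) \<le> remove_cells n r g i" for i
    using antimonoD[OF anti, of i "Suc i"] remove_cells_le[of n r g "Suc i"]
    by (auto simp: remove_cells_def split: if_splits)
  then have "antimono (remove_cells n r g)" by (simp add: antimono_iff_le_Suc)
  moreover obtain L where "\<forall>i\<ge>L. g i = 0" using assms by (auto simp: young_shape_def)
  then have "\<forall>i\<ge>L. remove_cells n r g i = 0" by (simp add: remove_cells_def)
  ultimately show ?thesis by (auto simp: young_shape_def)
qed

text \<open>A core cannot have both a removable and an addable cell of the same residue. Beads fill
  each residue class up to a maximum; the removable cell shows that the class of \<open>r\<close>
  reaches higher than that of \<open>r - 1\<close>, so the place following any bead of the latter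
  class is occupied.\<close>

lemma no_addable_if_removable:
  assumes core: "core_set n B" and b: "b \<in> B" "b - 1 \<notin> B" "int n dvd b - r"
    and x: "x \<in> B" "int n dvd x + 1 - r"
  shows "x + 1 \<in> B"
proof -
  have d: "int n dvd b - (x + 1)" using dvd_diff[OF b(3) x(2)] by (simp add: algebra_simps)
  have "x + 1 \<le> b"
  proof (rule ccontr)
    assume "\<not> x + 1 \<le> b"
    have "x - (b - 1) = - (b - (x + 1))" by simp
    then have "int n dvd x - (b - 1)" using d by (simp only: dvd_minus_iff)
    moreover have "b - 1 \<le> x" using \<open>\<not> x + 1 \<le> b\<close> by simp
    ultimately have "b - 1 \<in> B" using core_set_down[OF core x(1)] by blast
    then show False using b by simp
  qed
  then show ?thesis using core_set_down[OF core b(1) _ d] by simp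
qed

text \<open>Since no cell of residue \<open>r\<close> is addable, two places \<open>x - 1\<close>
  and \<open>x\<close> with \<open>x\<close> in the class of \<open>r\<close> are both full, both
  empty, or only \<open>x\<close> is full. Exchanging them affects only the third kind, where it
  lowers the bead, and this is the removal of a cell.\<close>

lemma beads_remove_cells:
  assumes n: "2 \<le> n" and anti: "antimono g" and core: "core_set n (beads g)"
    and rem: "int n dvd bead g i0 - r" "g (Suc i0) < g i0"
  shows "beads (remove_cells n r g) = {x. swap_residues n r x \<in> beads g}"
proof -
  let ?B = "beads g"
  let ?s = "swap_residues n r"
  have add: "x + 1 \<in> ?B" if "x \<in> ?B" "int n dvd x + 1 - r" for x
    using no_addable_if_removable[OF core _ _ rem(1) that] rem(2) bead_pred_notin[OF anti]
    by (auto simp: beads_def)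
  have rc: "bead (remove_cells n r g) i =
    (if int n dvd bead g i - r \<and> bead g i - 1 \<notin> ?B then bead g i - 1 else bead g i)" for i
    unfolding bead_pred_notin[OF anti] by (auto simp: bead_def remove_cells_def)
  have up: "\<not> int n dvd x + 1 - r" if "int n dvd x - r" for x
    using dvd_one_step(1)[OF n that] by (simp add: algebra_simps)
  show ?thesis
  proof (intro set_eqI iffI)
    fix x assume "x \<in> beads (remove_cells n r g)"
    then obtain i where i: "x = bead (remove_cells n r g) i" by (auto simp: beads_def)
    have bi: "bead g i \<in> ?B" by (simp add: beads_def)
    show "x \<in> {x. ?s x \<in> ?B}"
    proof (cases "int n dvd bead g i - r \<and> bead g i - 1 \<notin> ?B")
      case True
      then have "x = bead g i - 1" using i rc by simp
      moreover have "\<not> int n dvd x - r" using True up calculation by force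
      ultimately show ?thesis using True bi by (simp add: swap_residues_def)
    next
      case False
      then have "x = bead g i" using i rc by simp
      then show ?thesis using False bi add by (auto simp: swap_residues_def)
    qed
  next
    fix x assume "x \<in> {x. ?s x \<in> ?B}"
    then have sx: "?s x \<in> ?B" by simp
    have keep: "x \<in> beads (remove_cells n r g)"
      if "x \<in> ?B" "\<not> (int n dvd x - r \<and> x - 1 \<notin> ?B)"
    proof -
      obtain i where i: "x = bead g i" using \<open>x \<in> ?B\<close> by (auto simp: beads_def)
      then have "bead (remove_cells n r g) i = x" using that(2) rc[of i] by auto
      then show ?thesis by (auto simp: beads_def)
    qed
    show "x \<in> beads (remove_cells n r g)"
    proof (cases "int n dvd x - r")
      case True
      then have "x - 1 \<in> ?B" using sx by (simp add: swap_residues_def)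
      then show ?thesis using keep add[of "x - 1"] True by simp
    next
      case F: False
      show ?thesis
      proof (cases "int n dvd x + 1 - r \<and> x \<notin> ?B")
        case True
        then have "x + 1 \<in> ?B" using sx F by (simp add: swap_residues_def)
        then obtain i where i: "bead g i = x + 1" by (auto simp: beads_def)
        then have "bead (remove_cells n r g) i = x" using rc[of i] True by simp
        then show ?thesis by (auto simp: beads_def)
      next
        case False
        then have "x \<in> ?B" using sx F by (auto simp: swap_residues_def split: if_splits)
        then show ?thesis using keep F by simp
      qed
    qed
  qed
qed

lemma remove_cells_unchanged:
  assumes "\<not> (\<exists>i. int n dvd bead g i - r \<and> g (Suc i) < g i)"
  shows "remove_cells n r g = g"
  using assms by (auto simp: remove_cells_def fun_eq_iff)

lemma core_set_remove_cells:
  assumes n: "2 \<le> n" and anti: "antimono g" and core: "core_set n (beads g)"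
  shows "core_set n (beads (remove_cells n r g))"
proof (cases "\<exists>i. int n dvd bead g i - r \<and> g (Suc i) < g i")
  case True
  then obtain i where "int n dvd bead g i - r" "g (Suc i) < g i" by blast
  from beads_remove_cells[OF assms this] show ?thesis
    using core by (auto simp: core_set_def swap_residues_minus)
next
  case False
  from remove_cells_unchanged[OF this] show ?thesis using core by simp
qed

text \<open>
  The swap sends inversions to inversions except for the pairs \<open>(x, x - 1)\<close> given by the removable
  cells. All but the lowest of these are sent to inversions via \<open>(x, x - 1 - n)\<close> instead.
\<close>

lemma card_inversions_remove_cells:
  assumes n: "2 \<le> n" and shape: "young_shape g" and core: "core_set n (beads g)"
  shows "card (inversions n (beads g)) \<le> card (inversions n (beads (remove_cells n r g))) + 1"
proof (cases "\<exists>i. int n dvd bead g i - r \<and> g (Suc i) < g i")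
  case True
  then obtain i0 where i0: "int n dvd bead g i0 - r" "g (Suc i0) < g i0" by blast
  let ?B = "beads g" and ?B' = "beads (remove_cells n r g)"
  let ?s = "swap_residues n r"
  let ?P = "inversions n ?B" and ?P' = "inversions n ?B'"
  have anti: "antimono g" using shape by (simp add: young_shape_def)
  have B': "?s x \<in> ?B' \<longleftrightarrow> x \<in> ?B" for x
    using beads_remove_cells[OF n anti core i0] swap_residues_swap_residues[OF n] by simp
  have inj: "?s x = ?s y \<longleftrightarrow> x = y" for x y
    using swap_residues_swap_residues[OF n] by metis
  define E where "E = {(x, y). y = x - 1 \<and> x \<in> ?B \<and> x - 1 \<notin> ?B \<and> int n dvd x - r}"
  define E1 where "E1 = {(x, y) \<in> E. x - 1 - int n \<in> ?B}"
  define F where "F = (\<lambda>(b, c). if (b, c) \<in> E then (?s b, ?s (c - int n)) else (?s b, ?s c))"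
  have add: "x + 1 \<in> ?B" if "x \<in> ?B" "int n dvd x + 1 - r" for x
    using no_addable_if_removable[OF core _ _ i0(1) that] i0(2) bead_pred_notin[OF anti]
    by (auto simp: beads_def)
  \<comment> \<open>Of two removable cells of this residue, the upper bead exceeds the lower bead
    \<open>y\<close> by at least \<open>n\<close>. If the place \<open>n + 1\<close> below the upper
    bead were full, closure under subtracting \<open>n\<close> would fill \<open>y - 1\<close>. So
    only the lowest removable cell can belong to \<open>E1\<close>.\<close>
  have one: "e = e'" if e: "e \<in> E1" "e' \<in> E1" for e e'
  proof -
    have le: "x \<le> y" if x: "(x, x - 1) \<in> E1" and y: "(y, y - 1) \<in> E1" for x y
    proof (rule ccontr)
      assume less: "\<not> x \<le> y"
      have d: "int n dvd x - y" using x y dvd_diff[of "int n" "x - r" "y - r"]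
        by (auto simp: E1_def E_def)
      then have "int n \<le> x - y" using less zdvd_imp_le by simp
      moreover have "x - 1 - int n \<in> ?B" using x by (simp add: E1_def)
      moreover have "int n dvd (x - 1 - int n) - (y - 1)"
        using d by (metis diff_diff_eq2 diff_right_commute dvd_diff_right_iff dvd_refl
            dvd_diff_commute add_diff_cancel_right' diff_add_cancel)
      ultimately have "y - 1 \<in> ?B" using core_set_down[OF core] by simp
      then show False using y by (auto simp: E1_def E_def)
    qed
    obtain x where "e = (x, x - 1)" using e(1) by (auto simp: E1_def E_def)
    moreover obtain y where "e' = (y, y - 1)" using e(2) by (auto simp: E1_def E_def)
    ultimately show ?thesis using le[of x y] le[of y x] e by auto
  qed
  have finP: "finite ?P" and finP': "finite ?P'"
    using finite_inversions shape young_shape_remove_cells by blast+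
  have E_sub: "E \<subseteq> ?P" using n by (auto simp: E_def inversions_def)
  have E1_sub: "E1 \<subseteq> ?P" using E_sub by (auto simp: E1_def)
  then have "finite E1" using finP finite_subset by blast
  then have E1_card: "card E1 \<le> 1" using one by (simp add: card_le_Suc0_iff_eq)
  have maps: "F z \<in> ?P'" if z: "z \<in> ?P - E1" for z
  proof -
    obtain b c where bc: "z = (b, c)" by force
    have P: "b \<in> ?B" "c \<notin> ?B" "c < b" "b < c + int n"
      using z bc by (auto simp: inversions_def)
    show ?thesis
    proof (cases "(b, c) \<in> E")
      case True
      then have c: "c = b - 1" "int n dvd b - r" by (auto simp: E_def)
      have "c - int n \<notin> ?B" using True z bc c by (auto simp: E1_def)
      moreover have "?s b = b - 1" using c by (simp add: swap_residues_def)
      moreover have "?s (c - int n) = b - int n"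
      proof -
        have "\<not> int n dvd c - r" using dvd_one_step(2)[OF n c(2)] unfolding c(1) by (simp add: algebra_simps)
        then have "?s c = b" using c by (simp add: swap_residues_def)
        then show ?thesis by (simp add: swap_residues_minus)
      qed
      ultimately show ?thesis using True bc P B'[of b] B'[of "c - int n"] n
        by (simp add: F_def inversions_def)
    next
      case False
      define A where "A x \<longleftrightarrow> int n dvd x - r" for x
      have s: "?s x = (if A x then x - 1 else if A (x + 1) then x + 1 else x)" for x
        by (simp add: swap_residues_def A_def)
      have A_add: "A (x + int n) \<longleftrightarrow> A x" for x
        using dvd_add_left_iff[of "int n" "int n" "x - r"] by (simp add: A_def algebra_simps)
      \<comment> \<open>This excludes the case in which \<open>b\<close> moves up while
        \<open>c\<close> moves down, so the distance grows by at most one. In the boundary case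
        \<open>b + 1 = c + int n\<close> the two conditions are equivalent, hence both fail and the
        distance does not grow at all.\<close>
      have gap: "\<not> (A (b + 1) \<and> A c)"
      proof
        assume "A (b + 1) \<and> A c"
        then have d: "int n dvd b + 1 - r" "int n dvd c - r" by (simp_all add: A_def)
        then have "int n dvd b + 1 - c" using dvd_diff[OF d] by (simp add: algebra_simps)
        then have "c \<in> ?B" using core_set_down[OF core add[OF P(1) d(1)], of c] P(3) by simp
        then show False using P by simp
      qed
      have far: "\<not> A (b + 1) \<and> \<not> A c" if "b + 1 = c + int n"
        using gap A_add[of c] that by metis
      have "\<not> (A b \<and> b = c + 1)" using False P by (auto simp: E_def A_def)
      then have "?s c < ?s b"
        using P(3) gap inj[of b c] unfolding s[of b] s[of c] by (auto split: if_splits)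
      moreover have "?s b < ?s c + int n"
        using P(4) gap far unfolding s[of b] s[of c]
        by (cases "b + 1 = c + int n") (auto split: if_splits)
      ultimately show ?thesis using False bc P B' by (simp add: F_def inversions_def)
    qed
  qed
  have "inj_on F (?P - E1)"
  proof (rule inj_onI)
    fix z w assume z: "z \<in> ?P - E1" and w: "w \<in> ?P - E1" and eq: "F z = F w"
    obtain b c b' c' where bc: "z = (b, c)" "w = (b', c')" by force
    \<comment> \<open>With \<open>b\<close> fixed, the shifted value \<open>b - 1 - n\<close> lies
      below every unshifted one, as these exceed \<open>b - n\<close>. Hence the two kinds of pairs
      have no common image.\<close>
    define e where "e b c = (if (b, c) \<in> E then c - int n else c)" for b c
    have F: "F (b, c) = (?s b, ?s (e b c))" for b c by (simp add: F_def e_def)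
    have "b = b' \<and> e b c = e b' c'" using eq unfolding bc F prod.inject inj .
    then have b: "b = b'" and e: "e b c = e b' c'" by blast+
    have r: "c < b" "b < c + int n" "c' < b'" "b' < c' + int n"
      using z w unfolding bc inversions_def by blast+
    have E: "(b, c) \<notin> E \<or> c = b - 1" "(b', c') \<notin> E \<or> c' = b' - 1"
      unfolding E_def by blast+
    have "c = c'"
      using r E b e unfolding e_def
      by (elim disjE) (simp_all split: if_splits)
    then show "z = w" using b bc by simp
  qed
  then have "card (?P - E1) \<le> card ?P'"
    by (rule card_inj_on_le) (use maps finP' in blast)+
  moreover have "card (?P - E1) = card ?P - card E1"
    using E1_sub \<open>finite E1\<close> by (simp add: card_Diff_subset)
  ultimately show ?thesis using E1_card by simp
next
  case False
  from remove_cells_unchanged[OF this] show ?thesis by simp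
qed

section \<open>Horizontal strips in cores\<close>

text \<open>Otherwise the place just below the content of this column top would be congruent to the
  highest bead and not above it, hence a bead of the core. But that place is the gap belonging to
  the column.\<close>

lemma strip_avoids_first_bead:
  assumes n: "0 < n" and anti: "antimono g" and core: "core_set n (beads g)"
    and strip: "g (Suc i) \<le> j" "j < g i"
  shows "\<not> int n dvd int j - int i - bead g 0 - 1"
proof
  assume d: "int n dvd int j - int i - bead g 0 - 1"
  then have "int n dvd bead g 0 - (int j - int i - 1)"
    using dvd_minus_iff[of "int n" "int j - int i - bead g 0 - 1"] by (simp add: algebra_simps)
  moreover have "int j - int i - 1 \<le> bead g 0"
    using strip bead_le_iff[OF anti, of i 0] by (simp add: bead_def)
  moreover have "bead g 0 \<in> beads g" by (simp add: beads_def)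
  ultimately have "int j - int i - 1 \<in> beads g" using core_set_down[OF core] by blast
  then show False using column_top_gap[OF anti strip] by simp
qed

text \<open>
  No cell of the strip has the residue following that of the last cell of the first row. Starting
  from there the residues can be processed in decreasing cyclic order, so that the right neighbour
  of a strip cell is gone when the cell itself has to be removed.
\<close>

lemma core_below_horizontal_strip:
  assumes n: "2 \<le> n" and shape: "young_shape g" and core: "core_set n (beads g)"
    and horiz: "\<And>i. g (Suc i) \<le> h i" and le: "\<And>i. h i \<le> g i"
    and R: "\<And>i j. h i \<le> j \<Longrightarrow> j < g i \<Longrightarrow> (int j - int i) mod int n \<in> R" and "finite R"
  obtains g' where "young_shape g'" "core_set n (beads g')" "\<And>i. g' i \<le> h i"
    "card (inversions n (beads g)) \<le> card (inversions n (beads g')) + card R"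
proof -
  have anti: "antimono g" using shape by (simp add: young_shape_def)
  let ?b = "bead g 0"
  let ?U = "\<lambda>t. {u. u < t \<and> (?b - int u) mod int n \<in> R}"
  \<comment> \<open>Step \<open>u\<close> handles the residue of \<open>?b - u\<close>. The
    invariant says that the strip cells of all handled residues are gone, at a cost of at most one
    inversion for each handled residue in \<open>R\<close>.\<close>
  have "\<exists>g'. young_shape g' \<and> core_set n (beads g') \<and> (\<forall>i. g' i \<le> g i) \<and>
    (\<forall>u i j. u < t \<longrightarrow> h i \<le> j \<longrightarrow> j < g i \<longrightarrow> int n dvd int j - int i - (?b - int u) \<longrightarrow> g' i \<le> j) \<and>
    card (inversions n (beads g)) \<le> card (inversions n (beads g')) + card (?U t)" for t
  proof (induction t)
    case 0
    show ?case using shape core by (intro exI[of _ g]) auto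
  next
    case (Suc t)
    then obtain g' where g': "young_shape g'" "core_set n (beads g')" "\<And>i. g' i \<le> g i"
      and gone: "\<And>u i j. u < t \<Longrightarrow> h i \<le> j \<Longrightarrow> j < g i \<Longrightarrow>
        int n dvd int j - int i - (?b - int u) \<Longrightarrow> g' i \<le> j"
      and cd: "card (inversions n (beads g)) \<le> card (inversions n (beads g')) + card (?U t)"
      by blast
    show ?case
    proof (cases "(?b - int t) mod int n \<in> R")
      case False
      have "\<not> int n dvd int j - int i - (?b - int t)" if "h i \<le> j" "j < g i" for i j
        using R[OF that] False by (auto simp: mod_eq_dvd_iff[symmetric])
      then have "g' i \<le> j" if "u < Suc t" "h i \<le> j" "j < g i"
        "int n dvd int j - int i - (?b - int u)" for u i j
        using gone[of u] that less_Suc_eq by metis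
      moreover have "?U (Suc t) = ?U t" using False by (auto simp: less_Suc_eq)
      ultimately show ?thesis using g' cd by (intro exI[of _ g']) simp
    next
      case True
      let ?g = "remove_cells n (?b - int t) g'"
      have anti': "antimono g'" using g' by (simp add: young_shape_def)
      have "?g i \<le> j" if u: "u < Suc t" and s: "h i \<le> j" "j < g i"
        and d: "int n dvd int j - int i - (?b - int u)" for u i j
      proof (cases "u < t \<or> g' i \<le> j")
        case True
        then show ?thesis using gone[OF _ s d] remove_cells_le le_trans by blast
      next
        case False
        then have ut: "u = t" and jg: "j < g' i" using u by auto
        \<comment> \<open>The right neighbour, if it belongs to \<open>g\<close>, is a strip cell
          handled one step earlier. At \<open>t = 0\<close> there is no such neighbour, as its
          residue would be the one that the strip avoids.\<close>
        have "g' i \<le> Suc j"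
        proof (cases "Suc j < g i")
          case True
          have d': "int n dvd int (Suc j) - int i - (?b - (int t - 1))"
            using d ut by (simp add: algebra_simps)
          have "g (Suc i) \<le> Suc j" using horiz[of i] s by simp
          then have "\<not> int n dvd int (Suc j) - int i - ?b - 1"
            using strip_avoids_first_bead[OF _ anti core _ True] n by simp
          then have "t \<noteq> 0" using d' by (cases "t = 0") (simp_all add: algebra_simps)
          then have "int t - 1 = int (t - 1)" "t - 1 < t" by auto
          then show ?thesis using gone[of "t - 1" i "Suc j"] True s d' by simp
        qed (use g'(3)[of i] in simp)
        then have eq: "g' i = Suc j" using jg by simp
        moreover have "g' (Suc i) < g' i"
          using g'(3)[of "Suc i"] horiz[of i] s eq by simp
        moreover have "bead g' i = int j - int i" using eq by (simp add: bead_def)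
        ultimately show ?thesis using d ut by (simp add: remove_cells_def)
      qed
      moreover have "?U (Suc t) = insert t (?U t)" using True by (auto simp: less_Suc_eq)
      then have "card (?U (Suc t)) = card (?U t) + 1" by simp
      moreover have "?g i \<le> g i" for i using remove_cells_le g'(3) le_trans by blast
      moreover have "young_shape ?g" using young_shape_remove_cells g' by blast
      moreover have "core_set n (beads ?g)" using core_set_remove_cells[OF n anti' g'(2)] .
      moreover note card_inversions_remove_cells[OF n g'(1,2), of "?b - int t"]
      ultimately show ?thesis using cd by (intro exI[of _ ?g]) simp
    qed
  qed
  from this[of n] obtain g' where g': "young_shape g'" "core_set n (beads g')" "\<And>i. g' i \<le> g i"
    and gone: "\<And>u i j. u < n \<Longrightarrow> h i \<le> j \<Longrightarrow> j < g i \<Longrightarrow>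
      int n dvd int j - int i - (?b - int u) \<Longrightarrow> g' i \<le> j"
    and cd: "card (inversions n (beads g)) \<le> card (inversions n (beads g')) + card (?U n)"
    by blast
  have "g' i \<le> h i" for i
  proof (rule ccontr)
    assume less: "\<not> g' i \<le> h i"
    \<comment> \<open>The step that handles the first strip cell of row \<open>i\<close>.\<close>
    define u where "u = nat ((?b - (int (h i) - int i)) mod int n)"
    have u: "int u = (?b - (int (h i) - int i)) mod int n" "u < n"
      using n by (simp_all add: u_def nat_less_iff)
    have "int n dvd (?b - (int (h i) - int i)) - int u"
      unfolding u(1) by (simp add: minus_mod_eq_mult_div)
    then have "int n dvd int (h i) - int i - (?b - int u)"
      using dvd_minus_iff[of "int n" "int (h i) - int i - (?b - int u)"]
      by (simp add: algebra_simps)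
    then show False using gone[OF u(2), of i "h i"] less g'(3)[of i] by simp
  qed
  moreover have "card (?U n) \<le> card R"
  proof (rule card_inj_on_le)
    show "inj_on (\<lambda>u. (?b - int u) mod int n) (?U n)"
    proof (rule inj_onI)
      fix u v assume uv: "u \<in> ?U n" "v \<in> ?U n" and "(?b - int u) mod int n = (?b - int v) mod int n"
      then have "int n dvd int v - int u" by (simp add: mod_eq_dvd_iff)
      then have "int v mod int n = int u mod int n" by (simp add: mod_eq_dvd_iff)
      then show "u = v" using uv by simp
    qed
  qed (use \<open>finite R\<close> in auto)
  ultimately show ?thesis using that g' cd by simp
qed

section \<open>Residues of letters against inversions\<close>

lemma down_closed_nat_set:
  fixes S :: "nat set"
  assumes "finite S" "\<And>i j. j \<in> S \<Longrightarrow> i < j \<Longrightarrow> i \<in> S"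
  shows "S = {..<card S}"
proof -
  obtain m where m: "m \<notin> S" using assms(1) ex_new_if_finite infinite_UNIV_nat by blast
  define l where "l = (LEAST i. i \<notin> S)"
  have "l \<notin> S" unfolding l_def using m by (rule LeastI)
  moreover have "i \<in> S" if "i < l" for i using that not_less_Least unfolding l_def by blast
  ultimately have "S = {..<l}" using assms(2) by (metis lessThan_iff linorder_neqE_nat subsetI subset_antisym)
  then show ?thesis by simp
qed

lemma finite_young_shape_cells:
  assumes "young_shape g" shows "finite {(i, j). j < g i}"
proof -
  obtain L where L: "\<forall>i\<ge>L. g i = 0" using assms by (auto simp: young_shape_def)
  have "{(i, j). j < g i} \<subseteq> (SIGMA i:{..<L}. {..<g i})"
    using L by (auto simp: not_le[symmetric])
  then show ?thesis by (rule finite_subset) auto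
qed

text \<open>Induction on the number of letters. The cells with the largest letter form a horizontal
  strip, and a core \<open>g'\<close> inside the remaining shape loses at most one inversion for
  each residue of that strip. On \<open>g'\<close> the smaller letters still form a semistandard
  filling, with residue sets contained in the old ones.\<close>

lemma card_inversions_le_residue_counts:
  fixes T :: "nat \<times> nat \<Rightarrow> nat"
  assumes n: "2 \<le> n" and "young_shape g" "core_set n (beads g)"
    and row: "\<And>i j j'. j < j' \<Longrightarrow> j' < g i \<Longrightarrow> T (i, j) \<le> T (i, j')"
    and col: "\<And>i j. j < g (Suc i) \<Longrightarrow> T (i, j) < T (Suc i, j)"
    and bound: "\<And>i j. j < g i \<Longrightarrow> T (i, j) < N"
  shows "card (inversions n (beads g)) \<le>
    (\<Sum>x<N. card ((\<lambda>(i, j). (int j - int i) mod int n) ` {(i, j). j < g i \<and> T (i, j) = x}))"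
  using assms(2-)
proof (induction N arbitrary: g)
  case 0
  then have g0: "g i = 0" for i by fastforce
  have "b < 0 \<longleftrightarrow> b \<in> beads g" for b
  proof
    assume "b < 0"
    then show "b \<in> beads g" using beads_low[of 0 g b] g0 by simp
  qed (auto simp: beads_def bead_def g0)
  then have "beads g = {..<0}" by blast
  then have "inversions n (beads g) = {}" unfolding inversions_def by auto
  then show ?case by simp
next
  case (Suc N)
  let ?res = "\<lambda>(i, j). (int j - int i) mod int n"
  define h where "h i = card {j. j < g i \<and> T (i, j) < N}" for i
  have anti: "antimono g" using Suc.prems by (simp add: young_shape_def)
  have "{j. j < g i \<and> T (i, j) < N} = {..<card {j. j < g i \<and> T (i, j) < N}}" for i
    by (rule down_closed_nat_set) (use Suc.prems(3) in \<open>auto intro: le_less_trans less_trans\<close>)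
  then have h: "j < h i \<longleftrightarrow> j < g i \<and> T (i, j) < N" for i j
    unfolding h_def by blast
  have fin: "finite (?res ` {(i, j). j < g i \<and> T (i, j) = x})" for x
    by (intro finite_imageI finite_subset[OF _ finite_young_shape_cells[OF Suc.prems(1)]]) auto
  let ?R = "?res ` {(i, j). j < g i \<and> T (i, j) = N}"
  obtain g' where g': "young_shape g'" "core_set n (beads g')" "\<And>i. g' i \<le> h i"
    and cd: "card (inversions n (beads g)) \<le> card (inversions n (beads g')) + card ?R"
  proof (rule core_below_horizontal_strip[OF n Suc.prems(1,2), of h ?R])
    fix i
    show "h i \<le> g i" using h[of "g i" i] by simp
    show "g (Suc i) \<le> h i"
    proof (rule ccontr)
      assume "\<not> g (Suc i) \<le> h i"
      then have less: "h i < g (Suc i)" by simp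
      moreover have "g (Suc i) \<le> g i" using antimonoD[OF anti] by simp
      ultimately show False
        using h[of "h i" i] Suc.prems(4)[OF less] Suc.prems(5)[OF less] by simp
    qed
  next
    fix i j assume "h i \<le> j" "j < g i"
    then have "T (i, j) = N" using h[of j i] Suc.prems(5)[of j i] by simp
    then show "(int j - int i) mod int n \<in> ?R" using \<open>j < g i\<close> by force
  qed (use fin in blast)+
  have g'g: "j < g i" "T (i, j) < N" if "j < g' i" for i j
    using that g'(3)[of i] h[of j i] by auto
  have "card (inversions n (beads g')) \<le>
    (\<Sum>x<N. card (?res ` {(i, j). j < g' i \<and> T (i, j) = x}))"
    using Suc.IH[OF g'(1,2)] Suc.prems(3,4) g'g by blast
  also have "\<dots> \<le> (\<Sum>x<N. card (?res ` {(i, j). j < g i \<and> T (i, j) = x}))"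
    by (intro sum_mono card_mono fin image_mono) (use g'g in auto)
  finally show ?case using cd by simp
qed

section \<open>Hook lengths and inversions\<close>

definition row_fun :: "nat list \<Rightarrow> nat \<Rightarrow> nat" where
  "row_fun la i = part la (Suc i)"

definition gaps :: "nat \<Rightarrow> int set \<Rightarrow> int \<Rightarrow> int set" where
  "gaps n B b = {c. c \<notin> B \<and> b - int n < c \<and> c < b}"

definition column_height :: "(nat \<Rightarrow> nat) \<Rightarrow> nat \<Rightarrow> nat" where
  "column_height g j = card {i. j < g i}"

lemma row_fun_simps: "row_fun [] i = 0" "row_fun (p # la) 0 = p" "row_fun (p # la) (Suc i) = row_fun la i"
  by (simp_all add: row_fun_def part_def)

lemma row_fun_nth: "row_fun la i = (if i < length la then la ! i else 0)"
  by (simp add: row_fun_def part_def)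

lemma mem_cells_iff: "(i, j) \<in> cells la \<longleftrightarrow> 1 \<le> i \<and> 1 \<le> j \<and> j \<le> part la i"
  by (auto simp: cells_def part_def)

lemma Suc_mem_cells_iff: "(Suc i, Suc j) \<in> cells la \<longleftrightarrow> j < row_fun la i"
  by (auto simp: mem_cells_iff row_fun_def)

lemma young_shape_row_fun:
  assumes "sorted_wrt (\<ge>) la" shows "young_shape (row_fun la)"
proof -
  have "row_fun la j \<le> row_fun la i" if "i \<le> j" for i j
    using that assms by (cases "i = j") (auto simp: row_fun_nth sorted_wrt_iff_nth_less)
  then have "antimono (row_fun la)" by (auto intro: antimonoI)
  moreover have "\<forall>i\<ge>length la. row_fun la i = 0" by (simp add: row_fun_nth)
  ultimately show ?thesis by (auto simp: young_shape_def)
qed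

lemma less_column_height_iff:
  assumes "young_shape g" shows "i < column_height g j \<longleftrightarrow> j < g i"
proof -
  obtain L where L: "\<forall>i\<ge>L. g i = 0" using assms by (auto simp: young_shape_def)
  have "{i. j < g i} \<subseteq> {..<L}" using L by (auto simp: not_le[symmetric])
  then have "finite {i. j < g i}" by (rule finite_subset) simp
  moreover have "antimono g" using assms by (simp add: young_shape_def)
  then have "j < g i" if "j < g i'" "i < i'" for i i'
    using that antimonoD[of g i i'] by simp
  ultimately have "{i. j < g i} = {..<card {i. j < g i}}"
    by (intro down_closed_nat_set) auto
  then show ?thesis unfolding column_height_def by blast
qed

text \<open>The arm ends at the bead of the row and the leg at the gap of the column, where the gap
  of column \<open>j\<close> is the content of the cell just above its top. The hook length is the
  distance between the two.\<close>

lemma hook_length_eq: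
  assumes shape: "young_shape (row_fun la)" and j: "j < row_fun la i"
  shows "int (hook_length la (Suc i, Suc j)) =
    bead (row_fun la) i - (int j - int (column_height (row_fun la) j))"
proof -
  let ?g = "row_fun la" and ?H = "column_height (row_fun la)"
  note H = less_column_height_iff[OF shape]
  have "hook la (Suc i, Suc j) =
    (\<lambda>j. (Suc i, Suc j)) ` {j..<?g i} \<union> (\<lambda>i. (Suc i, Suc j)) ` {Suc i..<?H j}" (is "_ = ?A \<union> ?B")
  proof (intro set_eqI iffI)
    fix z assume z: "z \<in> hook la (Suc i, Suc j)"
    then have "z \<in> cells la" by (auto simp: hook_def)
    then have "1 \<le> fst z" "1 \<le> snd z" by (cases z; simp add: mem_cells_iff)+
    then obtain i' j' where z': "z = (Suc i', Suc j')"
      by (metis Suc_le_D One_nat_def prod.collapse)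
    have "j' < ?g i'" using z z' Suc_mem_cells_iff by (auto simp: hook_def)
    moreover have "i' = i \<and> j \<le> j' \<or> j' = j \<and> i \<le> i'" using z z' by (auto simp: hook_def)
    ultimately show "z \<in> ?A \<union> ?B" unfolding z' using H by (cases "i' = i") (auto simp: image_iff)
  next
    fix z assume "z \<in> ?A \<union> ?B"
    then show "z \<in> hook la (Suc i, Suc j)"
      using Suc_mem_cells_iff H by (auto simp: hook_def)
  qed
  moreover have "card (?A \<union> ?B) = card ?A + card ?B" by (rule card_Un_disjoint) auto
  moreover have "card ?A = ?g i - j" "card ?B = ?H j - Suc i"
    by (simp_all add: card_image inj_on_def)
  ultimately have "hook_length la (Suc i, Suc j) = (?g i - j) + (?H j - Suc i)"
    by (simp add: hook_length_def)
  moreover have "i < ?H j" using H j by simp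
  ultimately show ?thesis using j by (simp add: bead_def)
qed

text \<open>Columns correspond to gaps, and column \<open>j\<close> meets row \<open>i\<close>
  exactly if its gap lies below the bead of the row.\<close>

lemma column_heights_gaps:
  assumes shape: "young_shape g"
  shows "bij_betw (\<lambda>j. int j - int (column_height g j)) {..<g i} {c. c \<notin> beads g \<and> c < bead g i}"
proof -
  let ?H = "column_height g"
  have anti: "antimono g" using shape by (simp add: young_shape_def)
  note H = less_column_height_iff[OF shape]
  have mono: "?H j' \<le> ?H j" if "j \<le> j'" for j j'
    using that H by (metis le_less_trans not_le order_refl)
  have "strict_mono (\<lambda>j. int j - int (?H j))"
    by (rule strict_monoI) (smt (verit) mono of_nat_le_iff of_nat_less_iff less_imp_le)
  then have "inj_on (\<lambda>j. int j - int (?H j)) {..<g i}"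
    using strict_mono_imp_inj_on inj_on_subset by blast
  moreover have "(\<lambda>j. int j - int (?H j)) ` {..<g i} = {c. c \<notin> beads g \<and> c < bead g i}"
  proof (intro set_eqI iffI)
    fix c assume "c \<in> (\<lambda>j. int j - int (?H j)) ` {..<g i}"
    then obtain j where j: "j < g i" "c = int j - int (?H j)" by auto
    have "bead g l \<noteq> c" for l
    proof (cases "l < ?H j")
      case True
      then show ?thesis using H[of l j] j by (simp add: bead_def)
    next
      case False
      then show ?thesis using H[of l j] j by (simp add: bead_def)
    qed
    moreover have "i < ?H j" using H j by simp
    then have "c < bead g i" using j by (simp add: bead_def)
    ultimately show "c \<in> {c. c \<notin> beads g \<and> c < bead g i}" by (auto simp: beads_def)
  next
    fix c assume "c \<in> {c. c \<notin> beads g \<and> c < bead g i}"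
    then have c: "c \<notin> beads g" "c < bead g i" by auto
    \<comment> \<open>Exactly \<open>h\<close> rows have their bead above \<open>c\<close>, so a
      column with gap \<open>c\<close> must have height \<open>h\<close>; this forces its index to
      be \<open>c + h\<close>.\<close>
    define h where "h = card {l. c < bead g l}"
    obtain L where L: "\<forall>i\<ge>L. g i = 0" using shape by (auto simp: young_shape_def)
    have "- int L \<le> c" using beads_low[OF L, of c] c by force
    then have "{l. c < bead g l} \<subseteq> {..<L}"
      using L by (auto simp: bead_def not_le[symmetric])
    then have "finite {l. c < bead g l}" by (rule finite_subset) simp
    then have "{l. c < bead g l} = {..<h}"
      unfolding h_def using bead_less[OF anti] by (intro down_closed_nat_set) (auto intro: less_trans)
    then have h: "l < h \<longleftrightarrow> c < bead g l" for l by blast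
    have "i < h" using h c by simp
    have "bead g h \<noteq> c" using c unfolding beads_def by blast
    then have gh: "int (g h) \<le> c + int h" using h[of h] by (simp add: bead_def)
    define j where "j = nat (c + int h)"
    have j: "int j = c + int h" using gh by (simp add: j_def)
    have "j < g l \<longleftrightarrow> l < h" for l
    proof
      assume "j < g l"
      then show "l < h" using gh j antimonoD[OF anti, of h l] by (cases "l < h") auto
    next
      assume "l < h"
      then have "l \<le> h - 1" "c < bead g (h - 1)" using h[of "h - 1"] by auto
      then have "j < g (h - 1)" using j \<open>l < h\<close> by (simp add: bead_def)
      then show "j < g l" using antimonoD[OF anti \<open>l \<le> h - 1\<close>] by simp
    qed
    then have "?H j = h" "j < g i" using \<open>i < h\<close> by (simp_all add: column_height_def)
    then show "c \<in> (\<lambda>j. int j - int (?H j)) ` {..<g i}" using j by force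
  qed
  ultimately show ?thesis by (simp add: bij_betw_def)
qed

lemma card_small_hooks:
  assumes "sorted_wrt (\<ge>) la"
  shows "card {j. (Suc i, j) \<in> cells la \<and> hook_length la (Suc i, j) \<le> k} =
    card (gaps (k + 1) (beads (row_fun la)) (bead (row_fun la) i))"
proof -
  let ?g = "row_fun la"
  let ?f = "\<lambda>j. int j - int (column_height ?g j)"
  have shape: "young_shape ?g" using young_shape_row_fun[OF assms] .
  define J where "J = {j. j < ?g i \<and> bead ?g i - int (k + 1) < ?f j}"
  have hl: "hook_length la (Suc i, Suc j) \<le> k \<longleftrightarrow> bead ?g i - int (k + 1) < ?f j" if "j < ?g i" for j
    using hook_length_eq[OF shape that] by linarith
  have "{j. (Suc i, j) \<in> cells la \<and> hook_length la (Suc i, j) \<le> k} = Suc ` J"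
  proof (intro set_eqI iffI)
    fix j assume j: "j \<in> {j. (Suc i, j) \<in> cells la \<and> hook_length la (Suc i, j) \<le> k}"
    then obtain j' where "j = Suc j'" by (cases j) (auto simp: mem_cells_iff)
    then show "j \<in> Suc ` J" using j hl Suc_mem_cells_iff by (auto simp: J_def)
  qed (use hl Suc_mem_cells_iff in \<open>auto simp: J_def\<close>)
  moreover have bij: "bij_betw ?f {..<?g i} {c. c \<notin> beads ?g \<and> c < bead ?g i}"
    using column_heights_gaps[OF shape] .
  then have "?f ` J = gaps (k + 1) (beads ?g) (bead ?g i)"
    by (auto simp: J_def gaps_def bij_betw_def set_eq_iff image_iff) (metis lessThan_iff)+
  moreover have "inj_on ?f J"
    using bij unfolding bij_betw_def by (rule_tac inj_on_subset[of _ "{..<?g i}"]) (auto simp: J_def)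
  ultimately show ?thesis by (metis card_image inj_Suc inj_on_subset subset_UNIV)
qed

text \<open>A cell of hook length \<open>n\<close> in row \<open>i\<close> amounts to a gap exactly
  \<open>n\<close> below the bead of that row.\<close>

lemma is_core_iff:
  assumes "0 < n"
  shows "is_core n la \<longleftrightarrow> is_partition la \<and> core_set n (beads (row_fun la))"
proof (cases "is_partition la")
  case True
  let ?g = "row_fun la"
  let ?f = "\<lambda>j. int j - int (column_height ?g j)"
  have shape: "young_shape ?g" using True young_shape_row_fun by (simp add: is_partition_def)
  note bij = column_heights_gaps[OF shape]
  have "(\<exists>c\<in>cells la. hook_length la c = n) \<longleftrightarrow> (\<exists>i j. j < ?g i \<and> ?f j = bead ?g i - int n)"
  proof
    assume "\<exists>c\<in>cells la. hook_length la c = n"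
    then obtain i j where c: "(i, j) \<in> cells la" "hook_length la (i, j) = n" by auto
    then obtain i' j' where ij: "i = Suc i'" "j = Suc j'"
      by (cases i; cases j) (auto simp: mem_cells_iff)
    then have "j' < ?g i'" using c Suc_mem_cells_iff by simp
    then show "\<exists>i j. j < ?g i \<and> ?f j = bead ?g i - int n"
      using hook_length_eq[OF shape \<open>j' < ?g i'\<close>] c ij by force
  next
    assume "\<exists>i j. j < ?g i \<and> ?f j = bead ?g i - int n"
    then obtain i j where j: "j < ?g i" "?f j = bead ?g i - int n" by blast
    then have "hook_length la (Suc i, Suc j) = n" using hook_length_eq[OF shape j(1)] by linarith
    then show "\<exists>c\<in>cells la. hook_length la c = n" using j Suc_mem_cells_iff by blast
  qed
  also have "\<dots> \<longleftrightarrow> (\<exists>i. bead ?g i - int n \<in> ?f ` {..<?g i})"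
    unfolding image_iff by (metis lessThan_iff)
  also have "\<dots> \<longleftrightarrow> (\<exists>i. bead ?g i - int n \<notin> beads ?g)"
    using bij assms unfolding bij_betw_def by auto
  also have "\<dots> \<longleftrightarrow> \<not> core_set n (beads ?g)" by (auto simp: core_set_def beads_def)
  finally show ?thesis using True by (auto simp: is_core_def)
qed (simp add: is_core_def)

lemma card_inversions_eq_sum:
  assumes shape: "young_shape g" and L: "\<forall>i\<ge>L. g i = 0"
  shows "card (inversions n (beads g)) = (\<Sum>i<L. card (gaps n (beads g) (bead g i)))"
proof -
  have anti: "antimono g" using shape by (simp add: young_shape_def)
  have empty: "gaps n (beads g) (bead g i) = {}" if "L \<le> i" for i
  proof -
    have "c \<in> beads g" if "c < bead g i" for c
      by (rule beads_low[OF L]) (use that \<open>L \<le> i\<close> L in \<open>simp add: bead_def\<close>)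
    then show ?thesis by (auto simp: gaps_def)
  qed
  have "finite (gaps n (beads g) b)" for b
    by (rule finite_subset[of _ "{b - int n..b}"]) (auto simp: gaps_def)
  then have "(\<Sum>i<L. card (gaps n (beads g) (bead g i))) =
    card (SIGMA i:{..<L}. gaps n (beads g) (bead g i))" by simp
  also have "\<dots> = card (inversions n (beads g))"
  proof (rule bij_betw_same_card)
    let ?f = "\<lambda>(i, c). (bead g i, c)"
    have "inj_on ?f (SIGMA i:{..<L}. gaps n (beads g) (bead g i))"
      using inj_bead[OF anti] by (auto simp: inj_on_def)
    moreover have "?f ` (SIGMA i:{..<L}. gaps n (beads g) (bead g i)) = inversions n (beads g)"
    proof (intro set_eqI iffI)
      fix z assume "z \<in> ?f ` (SIGMA i:{..<L}. gaps n (beads g) (bead g i))"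
      then show "z \<in> inversions n (beads g)" by (auto simp: gaps_def inversions_def beads_def)
    next
      fix z assume "z \<in> inversions n (beads g)"
      then obtain i c where z: "z = (bead g i, c)" "c \<in> gaps n (beads g) (bead g i)"
        by (auto simp: gaps_def inversions_def beads_def)
      then have "i < L" using empty not_le by blast
      then show "z \<in> ?f ` (SIGMA i:{..<L}. gaps n (beads g) (bead g i))" using z by force
    qed
    ultimately show "bij_betw ?f (SIGMA i:{..<L}. gaps n (beads g) (bead g i)) (inversions n (beads g))"
      by (simp add: bij_betw_def)
  qed
  finally show ?thesis by simp
qed

section \<open>The core of a bounded partition\<close>

definition advance :: "nat \<Rightarrow> int list \<Rightarrow> nat \<Rightarrow> int list" where
  "advance n S p = take p S @ drop (Suc p) S @ [S ! p + int n]"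

text \<open>
  The state of a list of parts is the increasing list of the largest beads of each residue class,
  where beads are numbered so that adding a row below does not move them. Adding a row with \<open>p\<close>
  small cells moves the bead at position \<open>p\<close> up by \<open>n\<close>.
\<close>

fun core_state :: "nat \<Rightarrow> nat list \<Rightarrow> int list" where
  "core_state n [] = [- int n..-1]"
| "core_state n (p # ps) = advance n (core_state n ps) p"

text \<open>The first row of the list lies at the bottom, below the \<open>length ps\<close> rows of
  the rest. Its bead in the fixed numbering is its length plus \<open>length ps\<close>, and this
  has to equal the raised entry of the state.\<close>

fun core_rows :: "nat \<Rightarrow> nat list \<Rightarrow> nat list" where
  "core_rows n [] = []"
| "core_rows n (p # ps) = nat (core_state n ps ! p + int n - int (length ps)) # core_rows n ps"

text \<open>Here \<open>m\<close> stands for the part added last. The final clause says that raising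
  an entry at position \<open>m\<close> or later by \<open>n\<close> gives a new maximum; this keeps
  the list increasing as parts are added from the top row down, in weakly increasing order.\<close>

definition is_state :: "nat \<Rightarrow> nat \<Rightarrow> int list \<Rightarrow> bool" where
  "is_state n m S \<longleftrightarrow> length S = n \<and> sorted_wrt (<) S \<and>
     (\<forall>i<n. \<forall>j<n. int n dvd S ! i - S ! j \<longrightarrow> i = j) \<and>
     (\<forall>q<n. m \<le> q \<longrightarrow> last S < S ! q + int n)"

text \<open>The abacus whose runners are filled up to the entries of \<open>S\<close>.\<close>

definition runner_set :: "nat \<Rightarrow> int list \<Rightarrow> int set" where
  "runner_set n S = {x. \<exists>s\<in>set S. x \<le> s \<and> int n dvd s - x}"

text \<open>In contrast to \<open>is_partition\<close>, zero parts are allowed, for the sake of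
  padding; with \<open>n = k + 1\<close> the bound is \<open>k\<close>-boundedness.\<close>

definition restricted :: "nat \<Rightarrow> nat list \<Rightarrow> bool" where
  "restricted n la \<longleftrightarrow> sorted_wrt (\<ge>) la \<and> (\<forall>p\<in>set la. p < n)"

lemma restricted_Cons:
  "restricted n (p # ps) \<longleftrightarrow> p < n \<and> (\<forall>q\<in>set ps. q \<le> p) \<and> restricted n ps"
  by (auto simp: restricted_def)

lemma length_advance: "p < length S \<Longrightarrow> length (advance n S p) = length S"
  by (simp add: advance_def)

lemma nth_advance:
  assumes "p < length S" "i < length S"
  shows "advance n S p ! i =
    (if i < p then S ! i else if Suc i < length S then S ! Suc i else S ! p + int n)"
  using assms by (auto simp: advance_def nth_append min_def)

lemma last_advance: "last (advance n S p) = S ! p + int n"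
  by (simp add: advance_def)

lemma drop_advance:
  "p \<le> r \<Longrightarrow> r < length S \<Longrightarrow> drop p (advance n S r) = advance n (drop p S) (r - p)"
  by (simp add: advance_def drop_take)

lemma is_state_init: "0 < n \<Longrightarrow> is_state n 0 (core_state n [])"
proof -
  assume n: "0 < n"
  have "int n dvd int i - int j \<longrightarrow> i = j" if "i < n" "j < n" for i j
    using that by (metis mod_eq_dvd_iff mod_less of_nat_eq_iff of_nat_mod)
  then show ?thesis using n
    by (auto simp: is_state_def nth_upto last_conv_nth sorted_wrt_iff_nth_less)
qed

lemma is_state_nth_less: "is_state n m S \<Longrightarrow> i < j \<Longrightarrow> j < n \<Longrightarrow> S ! i < S ! j"
  by (simp add: is_state_def sorted_wrt_iff_nth_less)

lemma is_state_last: "is_state n m S \<Longrightarrow> i < n \<Longrightarrow> S ! i \<le> last S"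
proof -
  assume S: "is_state n m S" and i: "i < n"
  then have "S \<noteq> []" by (auto simp: is_state_def)
  then have "last S = S ! (n - 1)" using S by (simp add: is_state_def last_conv_nth)
  moreover have "i = n - 1 \<or> i < n - 1" using i by linarith
  ultimately show ?thesis using is_state_nth_less[OF S, of i "n - 1"] by auto
qed

lemma is_state_inj: "is_state n m S \<Longrightarrow> i < n \<Longrightarrow> j < n \<Longrightarrow> int n dvd S ! i - S ! j \<Longrightarrow> i = j"
  by (simp add: is_state_def)

lemma is_state_head: "is_state n m S \<Longrightarrow> q < n \<Longrightarrow> m \<le> q \<Longrightarrow> last S < S ! q + int n"
  by (simp add: is_state_def)

lemma is_state_advance:
  assumes S: "is_state n m S" and p: "m \<le> p" "p < n"
  shows "is_state n p (advance n S p)"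
proof -
  have len: "length S = n" using S by (simp add: is_state_def)
  note nth = nth_advance[of p S _ n, unfolded len, OF p(2)]
  have last: "S ! i < S ! p + int n" if "i < n" for i
    using is_state_last[OF S that] is_state_head[OF S p(2,1)] by simp
  have "advance n S p ! i < advance n S p ! j" if "i < j" "j < n" for i j
    using that is_state_nth_less[OF S, of i j] is_state_nth_less[OF S, of i "Suc j"]
      is_state_nth_less[OF S, of "Suc i" "Suc j"] last[of i] last[of "Suc i"]
    by (simp add: nth)
  moreover have "i = j" if "i < n" "j < n" "int n dvd advance n S p ! i - advance n S p ! j" for i j
  proof -
    \<comment> \<open>\<open>f i\<close> is the old position of the runner that is at position
      \<open>i\<close> after the move.\<close>
    define f where "f i = (if i < p then i else if Suc i < n then Suc i else p)" for i
    have f: "int n dvd advance n S p ! i - S ! f i" "f i < n" if "i < n" for i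
      using that p by (simp_all add: nth f_def)
    have "int n dvd (advance n S p ! i - advance n S p ! j) - (advance n S p ! i - S ! f i)
        + (advance n S p ! j - S ! f j)"
      by (rule dvd_add[OF dvd_diff[OF that(3) f(1)[OF that(1)]] f(1)[OF that(2)]])
    then have "int n dvd S ! f i - S ! f j" by simp
    then have "f i = f j" using is_state_inj[OF S] f that by blast
    then show "i = j" using that by (auto simp: f_def split: if_splits)
  qed
  moreover have "last (advance n S p) < advance n S p ! q + int n" if "q < n" "p \<le> q" for q
    using that is_state_nth_less[OF S, of p "Suc q"] p by (simp add: nth last_advance)
  ultimately show ?thesis
    using len p by (simp add: is_state_def length_advance sorted_wrt_iff_nth_less)
qed

lemma is_state_complete:
  assumes S: "is_state n m S" and n: "0 < n"
  obtains i where "i < n" "int n dvd x - S ! i"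
proof -
  let ?f = "\<lambda>i. nat (S ! i mod int n)"
  have "inj_on ?f {..<n}"
  proof (rule inj_onI)
    fix i j assume "i \<in> {..<n}" "j \<in> {..<n}" "?f i = ?f j"
    then show "i = j" using is_state_inj[OF S, of i j] n by (simp add: nat_eq_iff mod_eq_dvd_iff)
  qed
  moreover have "?f ` {..<n} \<subseteq> {..<n}" using n by (auto simp: nat_less_iff)
  ultimately have "?f ` {..<n} = {..<n}" by (simp add: endo_inj_surj)
  moreover have "nat (x mod int n) \<in> {..<n}" using n by (simp add: nat_less_iff)
  ultimately have "nat (x mod int n) \<in> ?f ` {..<n}" by (simp only:)
  then obtain i where i: "i < n" "nat (x mod int n) = nat (S ! i mod int n)" by auto
  then have "x mod int n = S ! i mod int n" using n by (simp add: nat_eq_iff)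
  then show ?thesis using that i by (simp add: mod_eq_dvd_iff)
qed

lemma runner_set_nth_iff:
  assumes S: "is_state n m S" and i: "i < n" and d: "int n dvd x - S ! i"
  shows "x \<in> runner_set n S \<longleftrightarrow> x \<le> S ! i"
proof
  assume "x \<in> runner_set n S"
  then obtain j where j: "j < n" "x \<le> S ! j" "int n dvd S ! j - x"
    using S by (auto simp: runner_set_def in_set_conv_nth is_state_def)
  have "int n dvd S ! j - S ! i" using dvd_add[OF j(3) d] by simp
  then show "x \<le> S ! i" using is_state_inj[OF S j(1) i] j by simp
next
  assume "x \<le> S ! i"
  moreover have "int n dvd S ! i - x" using d by (simp add: dvd_diff_commute)
  ultimately show "x \<in> runner_set n S"
    using S i unfolding runner_set_def is_state_def by force
qed

lemma runner_set_advance: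
  assumes S: "is_state n m S" and p: "p < n" and head: "m \<le> p"
  shows "runner_set n (advance n S p) = insert (S ! p + int n) (runner_set n S)"
proof (intro set_eqI)
  fix x
  have n: "0 < n" using p by simp
  have len: "length S = n" using S by (simp add: is_state_def)
  note nth = nth_advance[of p S _ n, unfolded len, OF p]
  have S': "is_state n p (advance n S p)" using is_state_advance[OF S head p] .
  obtain i where i: "i < n" "int n dvd x - S ! i" using is_state_complete[OF S n] .
  have not_p: "\<not> int n dvd S ! p + int n - S ! i" if "i < n" "i \<noteq> p" for i
    using is_state_inj[OF S p that(1)] that(2) dvd_add_left_iff[of "int n" "int n" "S ! p - S ! i"]
    by (auto simp: algebra_simps)
  consider "i < p" | "i = p" | "p < i" by linarith
  then show "x \<in> runner_set n (advance n S p) \<longleftrightarrow> x \<in> insert (S ! p + int n) (runner_set n S)"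
  proof cases
    case 1
    then have "x \<noteq> S ! p + int n"
      using not_p[OF i(1)] i by auto
    moreover have "advance n S p ! i = S ! i" using 1 i by (simp add: nth)
    ultimately show ?thesis
      using runner_set_nth_iff[OF S i] runner_set_nth_iff[OF S' i(1)] i by simp
  next
    case 2
    have a: "advance n S p ! (n - 1) = S ! p + int n" using p by (auto simp: nth)
    have d: "int n dvd x - (S ! p + int n)"
      using dvd_diff[OF i(2) dvd_refl] 2 by (simp add: algebra_simps)
    have "x \<in> runner_set n (advance n S p) \<longleftrightarrow> x \<le> S ! p + int n"
      using runner_set_nth_iff[OF S', of "n - 1" x] a d n by simp
    also have "\<dots> \<longleftrightarrow> x = S ! p + int n \<or> x \<le> S ! p"
      using i(2) 2 zdvd_imp_le[of "int n" "x - S ! p"] zdvd_imp_le[of "int n" "S ! p + int n - x"]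
        d by (smt (verit) dvd_diff_commute n of_nat_0_le_iff)
    finally show ?thesis using runner_set_nth_iff[OF S i] 2 by simp
  next
    case 3
    then have "x \<noteq> S ! p + int n"
      using not_p[OF i(1)] i by auto
    moreover have "advance n S p ! (i - 1) = S ! i" using 3 i by (auto simp: nth)
    ultimately show ?thesis
      using runner_set_nth_iff[OF S i] runner_set_nth_iff[OF S', of "i - 1" x] i by simp
  qed
qed

text \<open>Strictly between \<open>S ! p\<close> and \<open>S ! p + n\<close> every other residue
  class has exactly one place. It is free if the runner of the class ends below
  \<open>S ! p\<close>, and full if the runner ends above. The runners ending below are those at the
  \<open>p\<close> earlier positions.\<close>

lemma card_gaps_state:
  assumes S: "is_state n m S" and p: "p < n"
  shows "card (gaps n (runner_set n S) (S ! p + int n)) = p"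
proof -
  let ?f = "\<lambda>i. S ! p + (S ! i - S ! p) mod int n"
  have n: "0 < n" using p by simp
  have d: "int n dvd ?f i - S ! i" for i
  proof -
    have "?f i - S ! i = - ((S ! i - S ! p) - (S ! i - S ! p) mod int n)" by simp
    then show ?thesis by (simp only: dvd_minus_iff minus_mod_eq_mult_div dvd_triv_left)
  qed
  have "bij_betw ?f {..<p} (gaps n (runner_set n S) (S ! p + int n))"
  proof (rule bij_betwI')
    fix i j assume "i \<in> {..<p}" "j \<in> {..<p}"
    then show "?f i = ?f j \<longleftrightarrow> i = j"
      using is_state_inj[OF S, of i j] p by (auto simp: mod_eq_dvd_iff)
  next
    fix i assume i: "i \<in> {..<p}"
    then have less: "S ! i < S ! p" using is_state_nth_less[OF S _ p] by simp
    have range: "0 \<le> (S ! i - S ! p) mod int n" "(S ! i - S ! p) mod int n < int n"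
      using n by simp_all
    have nonzero: "(S ! i - S ! p) mod int n \<noteq> 0"
      using is_state_inj[OF S, of i p] i p by auto
    have "\<not> ?f i \<le> S ! i" using less range by linarith
    moreover have "i < n" using i p by simp
    ultimately have "?f i \<notin> runner_set n S" using runner_set_nth_iff[OF S _ d] by blast
    then show "?f i \<in> gaps n (runner_set n S) (S ! p + int n)"
      using range nonzero by (simp add: gaps_def)
  next
    fix c assume "c \<in> gaps n (runner_set n S) (S ! p + int n)"
    then have c: "c \<notin> runner_set n S" "S ! p < c" "c < S ! p + int n" by (auto simp: gaps_def)
    obtain i where i: "i < n" "int n dvd c - S ! i" using is_state_complete[OF S n] .
    then have "S ! i < c" using runner_set_nth_iff[OF S i] c by simp
    then have "S ! i + int n \<le> c" using i(2) zdvd_imp_le[of "int n" "c - S ! i"] by simp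
    then have "S ! i < S ! p" using c by simp
    then have "i < p" using is_state_nth_less[OF S _ i(1), of p] by (metis linorder_neqE_nat order_less_asym)
    moreover have "(c - S ! p) mod int n = (S ! i - S ! p) mod int n"
      using i(2) by (simp add: mod_eq_dvd_iff)
    then have "c = ?f i" using c by simp
    ultimately show "\<exists>i\<in>{..<p}. c = ?f i" by blast
  qed
  then show ?thesis using bij_betw_same_card by fastforce
qed

text \<open>The lower bound on the last entry ensures that \<open>nat\<close> in
  \<open>core_rows\<close> never truncates: the raised entry exceeds the last entry of the old
  state, hence is at least the number of rows above.\<close>

lemma is_state_core_state:
  assumes n: "0 < n" and "restricted n la"
  shows "is_state n (case la of [] \<Rightarrow> 0 | p # ps \<Rightarrow> p) (core_state n la) \<and>
    int (length la) - 1 \<le> last (core_state n la)"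
  using assms(2)
proof (induction la)
  case Nil
  then show ?case using is_state_init[OF n] n by (simp add: last_conv_nth nth_upto)
next
  case (Cons p ps)
  let ?m = "case ps of [] \<Rightarrow> 0 | p # ps \<Rightarrow> p"
  have p: "p < n" "?m \<le> p" and IH: "is_state n ?m (core_state n ps)"
    "int (length ps) - 1 \<le> last (core_state n ps)"
    using Cons by (auto simp: restricted_Cons split: list.splits)
  then show ?case
    using is_state_advance[OF IH(1) p(2,1)] is_state_head[OF IH(1) p] by (simp add: last_advance)
qed

lemma core_state_Cons:
  assumes "0 < n" "restricted n (p # ps)"
  obtains m where "is_state n m (core_state n ps)" "m \<le> p" "p < n"
    "int (length ps) - 1 \<le> last (core_state n ps)"
    "last (core_state n ps) < core_state n ps ! p + int n"
    "int (nat (core_state n ps ! p + int n - int (length ps))) = core_state n ps ! p + int n - int (length ps)"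
proof -
  let ?m = "case ps of [] \<Rightarrow> 0 | p # ps \<Rightarrow> p"
  have p: "p < n" "?m \<le> p" and r: "restricted n ps"
    using assms(2) by (auto simp: restricted_Cons split: list.splits)
  note st = is_state_core_state[OF assms(1) r]
  then show ?thesis using that[of ?m] p is_state_head[of n ?m "core_state n ps" p] by simp
qed

lemma length_core_rows [simp]: "length (core_rows n la) = length la"
  by (induction la) auto

text \<open>For a nonempty list the bound is the length of the bottom row; it is carried along to
  compare the next row with all rows above it.\<close>

lemma sorted_core_rows:
  assumes n: "0 < n" and "restricted n la"
  shows "sorted_wrt (\<ge>) (core_rows n la) \<and>
    (\<forall>r\<in>set (core_rows n la). int r \<le> last (core_state n la) + 1 - int (length la))"
  using assms(2)
proof (induction la)
  case (Cons p ps)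
  have "restricted n ps" using Cons.prems by (simp add: restricted_Cons)
  with Cons.IH show ?case
    by (rule_tac core_state_Cons[OF n Cons.prems]) (fastforce simp: last_advance)
qed simp

section \<open>Peeling off the bottom row\<close>

lemma beads_Suc:
  "x \<in> beads g \<longleftrightarrow> x = bead g 0 \<or> x + 1 \<in> beads (g \<circ> Suc)"
proof
  assume "x \<in> beads g"
  then obtain i where i: "x = bead g i" by (auto simp: beads_def)
  show "x = bead g 0 \<or> x + 1 \<in> beads (g \<circ> Suc)"
  proof (cases i)
    case (Suc i')
    then have "x + 1 = bead (g \<circ> Suc) i'" using i by (simp add: bead_def)
    then show ?thesis by (simp add: beads_def)
  qed (use i in simp)
next
  assume "x = bead g 0 \<or> x + 1 \<in> beads (g \<circ> Suc)"
  then show "x \<in> beads g"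
  proof
    assume "x + 1 \<in> beads (g \<circ> Suc)"
    then obtain i where "x + 1 = bead (g \<circ> Suc) i" by (auto simp: beads_def)
    then have "x = bead g (Suc i)" by (simp add: bead_def)
    then show ?thesis by (simp add: beads_def)
  qed (simp add: beads_def)
qed

lemma card_gaps_shift: "card (gaps n {x. x + a \<in> B} b) = card (gaps n B (b + a))"
proof (rule bij_betw_same_card)
  show "bij_betw (\<lambda>x. x + a) (gaps n {x. x + a \<in> B} b) (gaps n B (b + a))"
    by (rule bij_betw_byWitness[of _ "\<lambda>x. x - a"]) (auto simp: gaps_def)
qed

lemma row_fun_Cons_comp: "row_fun (p # ps) \<circ> Suc = row_fun ps"
  by (simp add: fun_eq_iff row_fun_simps)

lemma antimono_comp_Suc: "antimono g \<Longrightarrow> antimono (g \<circ> Suc)"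
  by (simp add: antimono_def)

lemma card_gaps_first_row:
  "card (gaps n (beads g) (bead g 0)) = card (gaps n (beads (g \<circ> Suc)) (bead g 0 + 1))"
proof -
  have "gaps n (beads g) (bead g 0) = gaps n {x. x + 1 \<in> beads (g \<circ> Suc)} (bead g 0)"
    using beads_Suc[of _ g] by (auto simp: gaps_def)
  then show ?thesis by (simp add: card_gaps_shift)
qed

lemma card_gaps_Suc:
  assumes "antimono g"
  shows "card (gaps n (beads g) (bead g (Suc i))) =
    card (gaps n (beads (g \<circ> Suc)) (bead (g \<circ> Suc) i))"
proof -
  have "bead g (Suc i) < bead g 0" using bead_less[OF assms] by simp
  then have "gaps n (beads g) (bead g (Suc i)) = gaps n {x. x + 1 \<in> beads (g \<circ> Suc)} (bead g (Suc i))"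
    using beads_Suc[of _ g] by (auto simp: gaps_def)
  moreover have "bead g (Suc i) + 1 = bead (g \<circ> Suc) i" by (simp add: bead_def)
  ultimately show ?thesis by (simp add: card_gaps_shift)
qed

lemma beads_core_rows:
  assumes n: "0 < n" and "restricted n la"
  shows "beads (row_fun (core_rows n la)) = {x. x + int (length la) \<in> runner_set n (core_state n la)}"
  using assms(2)
proof (induction la)
  case Nil
  have "x \<in> beads (row_fun []) \<longleftrightarrow> x < 0" for x
    using beads_low[of 0 "row_fun []" x]
    by (auto simp: row_fun_simps beads_def bead_def)
  moreover have "x \<in> runner_set n [- int n..-1] \<longleftrightarrow> x < 0" for x
  proof
    assume "x < 0"
    \<comment> \<open>The witness is the largest negative number congruent to
      \<open>x\<close>.\<close>
    have "- 1 - (- 1 - x) mod int n - x = (- 1 - x) - (- 1 - x) mod int n" by simp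
    then have "int n dvd - 1 - (- 1 - x) mod int n - x"
      by (simp only: minus_mod_eq_mult_div dvd_triv_left)
    moreover have "0 \<le> (- 1 - x) mod int n" "(- 1 - x) mod int n < int n" using n by simp_all
    moreover have "(- 1 - x) mod int n \<le> - 1 - x" using \<open>x < 0\<close> by (simp add: zmod_le_nonneg_dividend)
    ultimately show "x \<in> runner_set n [- int n..-1]"
      unfolding runner_set_def by (auto intro!: bexI[of _ "- 1 - (- 1 - x) mod int n"])
  qed (auto simp: runner_set_def)
  ultimately show ?case by auto
next
  case (Cons p ps)
  let ?S = "core_state n ps"
  obtain m where m: "is_state n m ?S" "m \<le> p" "p < n"
    and row: "int (nat (?S ! p + int n - int (length ps))) = ?S ! p + int n - int (length ps)"
    by (rule core_state_Cons[OF n Cons.prems])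
  have IH: "beads (row_fun (core_rows n ps)) = {x. x + int (length ps) \<in> runner_set n ?S}"
    using Cons by (simp add: restricted_Cons)
  show ?case
  proof (rule set_eqI)
    fix x
    have "x \<in> beads (row_fun (core_rows n (p # ps))) \<longleftrightarrow>
      x = ?S ! p + int n - int (length ps) - 1 \<or> x + 1 + int (length ps) \<in> runner_set n ?S"
      using beads_Suc[of x "row_fun (core_rows n (p # ps))"] IH row
      by (simp add: row_fun_Cons_comp bead_def row_fun_simps)
    also have "\<dots> \<longleftrightarrow> x + int (length (p # ps)) \<in> runner_set n (core_state n (p # ps))"
      using runner_set_advance[OF m(1,3,2)] by (auto simp: algebra_simps)
    finally show "x \<in> beads (row_fun (core_rows n (p # ps))) \<longleftrightarrow>
      x \<in> {x. x + int (length (p # ps)) \<in> runner_set n (core_state n (p # ps))}" by simp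
  qed
qed

lemma core_set_core_rows:
  assumes n: "0 < n" and "restricted n la"
  shows "core_set n (beads (row_fun (core_rows n la)))"
proof (unfold core_set_def, intro ballI)
  fix b assume "b \<in> beads (row_fun (core_rows n la))"
  then obtain s where s: "s \<in> set (core_state n la)" "b + int (length la) \<le> s"
    "int n dvd s - (b + int (length la))"
    unfolding beads_core_rows[OF assms] runner_set_def by blast
  have "int n dvd s - (b - int n + int (length la))"
    using dvd_add[OF s(3) dvd_refl] by (simp add: algebra_simps)
  then show "b - int n \<in> beads (row_fun (core_rows n la))"
    using s(1,2) unfolding beads_core_rows[OF assms] runner_set_def
    by (intro CollectI bexI[of _ s] conjI) auto
qed

lemma young_shape_core_rows:
  "0 < n \<Longrightarrow> restricted n la \<Longrightarrow> young_shape (row_fun (core_rows n la))"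
  using sorted_core_rows young_shape_row_fun by blast

lemma card_gaps_core_rows:
  assumes n: "0 < n" and "restricted n la"
  shows "card (gaps n (beads (row_fun (core_rows n la))) (bead (row_fun (core_rows n la)) i)) =
    row_fun la i"
  using assms(2)
proof (induction la arbitrary: i)
  case Nil
  have "x \<in> beads (row_fun [])" if "x < 0" for x
    using beads_low[of 0 "row_fun []" x] that by (simp add: row_fun_simps)
  then have "gaps n (beads (row_fun [])) (bead (row_fun []) i) = {}"
    by (auto simp: gaps_def bead_def row_fun_simps)
  then show ?case by (metis card.empty core_rows.simps(1) row_fun_simps(1))
next
  case (Cons p ps)
  let ?S = "core_state n ps" and ?g = "row_fun (core_rows n (p # ps))"
  obtain m where m: "is_state n m ?S" "m \<le> p" "p < n"
    and row: "int (nat (?S ! p + int n - int (length ps))) = ?S ! p + int n - int (length ps)"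
    by (rule core_state_Cons[OF n Cons.prems])
  have ps: "restricted n ps" using Cons.prems by (simp add: restricted_Cons)
  have anti: "antimono ?g" using young_shape_core_rows[OF n Cons.prems] by (simp add: young_shape_def)
  show ?case
  proof (cases i)
    case 0
    have "bead ?g 0 + 1 + int (length ps) = ?S ! p + int n"
      using row by (simp add: bead_def row_fun_simps)
    then show ?thesis
      using card_gaps_first_row[of n ?g] 0 card_gaps_state[OF m(1,3)] beads_core_rows[OF n ps]
      by (simp add: row_fun_Cons_comp card_gaps_shift row_fun_simps)
  next
    case (Suc i')
    then show ?thesis using card_gaps_Suc[OF anti, of n i'] Cons.IH[OF ps, of i']
      by (simp add: row_fun_Cons_comp row_fun_simps)
  qed
qed

text \<open>By induction the rows above the bottom one are determined. The bottom bead is not among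
  their beads, but by the core property it becomes one when lowered by \<open>n\<close>; so it is an
  entry of their state raised by \<open>n\<close>. The number of small cells in the bottom row is
  the position of that entry. In the base case, a nonempty shape would have a removable cell, whose
  hook length is 1.\<close>

lemma core_rows_unique:
  assumes n: "2 \<le> n" and "restricted n la" "young_shape g" "core_set n (beads g)"
    "\<And>i. card (gaps n (beads g) (bead g i)) = row_fun la i"
  shows "g = row_fun (core_rows n la)"
  using assms(2-)
proof (induction la arbitrary: g)
  case Nil
  have anti: "antimono g" using Nil.prems by (simp add: young_shape_def)
  obtain L where L: "\<forall>i\<ge>L. g i = 0" using Nil.prems by (auto simp: young_shape_def)
  have "g i \<le> g (Suc i)" for i
  proof (rule ccontr)
    assume "\<not> g i \<le> g (Suc i)"
    then have "bead g i - 1 \<notin> beads g" using bead_pred_notin[OF anti] by simp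
    then have "bead g i - 1 \<in> gaps n (beads g) (bead g i)" using n by (simp add: gaps_def)
    moreover have "finite (gaps n (beads g) (bead g i))"
      by (rule finite_subset[of _ "{bead g i - int n..bead g i}"]) (auto simp: gaps_def)
    ultimately show False using Nil.prems(4)[of i] by (auto simp: row_fun_simps)
  qed
  then have "g i \<le> g (i + L)" for i by (metis add.commute le_add2 lift_Suc_mono_le)
  then have "g i = 0" for i using L by (metis le_add2 le_zero_eq)
  then show ?case by (auto simp: row_fun_simps fun_eq_iff)
next
  case (Cons p ps)
  let ?S = "core_state n ps"
  have n0: "0 < n" using n by simp
  obtain m where m: "is_state n m ?S" "m \<le> p" "p < n"
    and row: "int (nat (?S ! p + int n - int (length ps))) = ?S ! p + int n - int (length ps)"
    by (rule core_state_Cons[OF n0 Cons.prems(1)])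
  have ps: "restricted n ps" using Cons.prems by (simp add: restricted_Cons)
  have anti: "antimono g" using Cons.prems by (simp add: young_shape_def)
  let ?g = "g \<circ> Suc"
  have shape: "young_shape ?g"
    using Cons.prems(2) antimono_comp_Suc[OF anti] unfolding young_shape_def by (auto intro: le_SucI)
  have below: "x \<in> beads ?g \<longleftrightarrow> x - 1 \<in> beads g \<and> x - 1 < bead g 0" for x
  proof -
    have "x - 1 < bead g 0" if "x \<in> beads ?g"
    proof -
      obtain i where i: "x = bead ?g i" using \<open>x \<in> beads ?g\<close> by (auto simp: beads_def)
      then have "x - 1 = bead g (Suc i)" by (simp add: bead_def)
      then show ?thesis using bead_less[OF anti, of 0 "Suc i"] by simp
    qed
    then show ?thesis using beads_Suc[of "x - 1" g] by auto
  qed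
  have "core_set n (beads ?g)"
  proof (unfold core_set_def, intro ballI)
    fix b assume b: "b \<in> beads ?g"
    then have "b - 1 - int n \<in> beads g" using below[of b] Cons.prems(3) by (simp add: core_set_def)
    moreover have "b - 1 - int n < bead g 0" using b below[of b] by simp
    ultimately show "b - int n \<in> beads ?g" using below[of "b - int n"] by (simp add: algebra_simps)
  qed
  moreover have "card (gaps n (beads ?g) (bead ?g i)) = row_fun ps i" for i
    using Cons.prems(4)[of "Suc i"] card_gaps_Suc[OF anti, of n i] by (simp add: row_fun_simps)
  ultimately have g: "?g = row_fun (core_rows n ps)" using Cons.IH[OF ps shape] by blast
  define y where "y = bead g 0 + 1 + int (length ps)"
  have B: "x \<in> beads ?g \<longleftrightarrow> x + int (length ps) \<in> runner_set n ?S" for x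
    unfolding g beads_core_rows[OF n0 ps] by simp
  have "y \<notin> runner_set n ?S" using B[of "bead g 0 + 1"] below[of "bead g 0 + 1"] by (simp add: y_def)
  moreover have "bead g 0 - int n \<in> beads g" using Cons.prems(3) by (simp add: core_set_def beads_def)
  then have "y - int n \<in> runner_set n ?S"
    using B[of "bead g 0 + 1 - int n"] below[of "bead g 0 + 1 - int n"] n
    by (simp add: y_def algebra_simps)
  moreover obtain i where i: "i < n" "int n dvd y - ?S ! i" using is_state_complete[OF m(1) n0] .
  moreover have "int n dvd y - int n - ?S ! i"
    using dvd_diff[OF i(2) dvd_refl] by (simp add: algebra_simps)
  ultimately have "?S ! i < y" "y - int n \<le> ?S ! i"
    using runner_set_nth_iff[OF m(1) i(1)] by (auto simp: not_le[symmetric])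
  then have y: "y = ?S ! i + int n" using zdvd_imp_le[OF i(2)] by simp
  have "p = card (gaps n (beads ?g) (bead g 0 + 1))"
    using Cons.prems(4)[of 0] card_gaps_first_row[of n g] by (simp add: row_fun_simps)
  also have "\<dots> = card (gaps n {x. x + int (length ps) \<in> runner_set n ?S} (bead g 0 + 1))"
    unfolding g beads_core_rows[OF n0 ps] by simp
  also have "\<dots> = card (gaps n (runner_set n ?S) y)" by (simp add: card_gaps_shift y_def)
  also have "\<dots> = i" using card_gaps_state[OF m(1) i(1)] y by simp
  finally have "int (g 0) = ?S ! p + int n - int (length ps)" using y by (simp add: y_def bead_def)
  then have "g 0 = row_fun (core_rows n (p # ps)) 0" by (simp add: row_fun_simps)
  moreover have "g (Suc i) = row_fun (core_rows n (p # ps)) (Suc i)" for i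
    using fun_cong[OF g, of i] by (simp add: row_fun_simps)
  ultimately show ?case by (metis ext not0_implies_Suc)
qed

section \<open>Identification of \<open>core_of\<close>\<close>

lemma row_fun_inject:
  assumes "is_partition la" "is_partition mu" "row_fun la = row_fun mu"
  shows "la = mu"
proof -
  have len: "i < length la \<longleftrightarrow> 0 < row_fun la i" if "is_partition la" for la i
    using that by (auto simp: row_fun_nth is_partition_def)
  then have "i < length la \<longleftrightarrow> i < length mu" for i using assms by simp
  then have "length la = length mu" by (metis linorder_neqE_nat order_less_irrefl)
  moreover have "la ! i = mu ! i" if "i < length la" for i
    using fun_cong[OF assms(3), of i] that calculation by (simp add: row_fun_nth)
  ultimately show ?thesis by (intro nth_equalityI)
qed

lemma core_of_eq_core_rows:
  assumes "0 < k" "is_partition la" "k_bounded k la"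
  shows "core_of k la = core_rows (k + 1) la" "is_partition (core_rows (k + 1) la)"
proof -
  let ?n = "k + 1" and ?c = "core_rows (k + 1) la"
  have n: "0 < ?n" "2 \<le> ?n" using assms by auto
  have r: "restricted ?n la"
    using assms by (auto simp: restricted_def is_partition_def k_bounded_def less_Suc_eq_le)
  note shape = young_shape_core_rows[OF n(1) r]
  \<comment> \<open>An empty row has no gap below its bead, whereas a row coming from a positive
    part has that many gaps.\<close>
  have "0 < row_fun ?c i" if "i < length la" for i
  proof (rule ccontr)
    assume "\<not> 0 < row_fun ?c i"
    then have zero: "row_fun ?c i = 0" by simp
    have "\<forall>j\<ge>i. row_fun ?c j = 0"
      using shape zero by (metis antimonoD le_zero_eq young_shape_def)
    then have "x \<in> beads (row_fun ?c)" if "x < bead (row_fun ?c) i" for x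
      using beads_low[of i] that zero by (simp add: bead_def)
    then have "gaps ?n (beads (row_fun ?c)) (bead (row_fun ?c) i) = {}" by (auto simp: gaps_def)
    then have "row_fun la i = 0" using card_gaps_core_rows[OF n(1) r, of i] by simp
    then show False using that assms(2) nth_mem[of i la] by (auto simp: row_fun_nth is_partition_def)
  qed
  then show part: "is_partition ?c"
    using sorted_core_rows[OF n(1) r]
    by (auto simp: is_partition_def in_set_conv_nth row_fun_nth)
  have counts: "(\<forall>i\<ge>1. card {j. (i, j) \<in> cells ga \<and> hook_length ga (i, j) \<le> k} = part la i) \<longleftrightarrow>
      (\<forall>i. card (gaps ?n (beads (row_fun ga)) (bead (row_fun ga) i)) = row_fun la i)"
    if "is_partition ga" for ga
  proof -
    have "sorted_wrt (\<ge>) ga" using that by (simp add: is_partition_def)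
    note cd = card_small_hooks[OF this]
    have "(\<forall>i\<ge>1. P i) \<longleftrightarrow> (\<forall>i. P (Suc i))" for P :: "nat \<Rightarrow> bool"
      by (metis One_nat_def Suc_le_mono le0 not0_implies_Suc not_one_le_zero)
    then show ?thesis unfolding row_fun_def[of la] by (simp only: cd)
  qed
  show "core_of k la = ?c"
    unfolding core_of_def
  proof (rule the_equality)
    show "is_core ?n ?c \<and>
      (\<forall>i\<ge>1. card {j. (i, j) \<in> cells ?c \<and> hook_length ?c (i, j) \<le> k} = part la i)"
      using part counts[OF part] core_set_core_rows[OF n(1) r] card_gaps_core_rows[OF n(1) r]
        is_core_iff[OF n(1)] by simp
  next
    fix ga assume ga: "is_core ?n ga \<and>
      (\<forall>i\<ge>1. card {j. (i, j) \<in> cells ga \<and> hook_length ga (i, j) \<le> k} = part la i)"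
    then have p: "is_partition ga" "core_set ?n (beads (row_fun ga))"
      using is_core_iff[OF n(1)] by auto
    then have "row_fun ga = row_fun ?c"
      using core_rows_unique[OF n(2) r _ p(2)] young_shape_row_fun counts[OF p(1)] ga
      by (simp add: is_partition_def)
    then show "ga = ?c" using row_fun_inject p part by blast
  qed
qed

section \<open>Residue counts of tableaux on the upper rows\<close>

lemma sum_row_fun: "(\<Sum>j<i. row_fun la j) = sum_list (take i la)"
proof (induction la arbitrary: i)
  case (Cons p la)
  then show ?case
    by (cases i) (simp_all add: sum.lessThan_Suc_shift row_fun_simps del: sum.lessThan_Suc)
qed (simp add: row_fun_simps)

lemma sum_part: "(\<Sum>j = 1..i. part la j) = sum_list (take i la)"
proof -
  have "(\<Sum>j = 1..i. part la j) = (\<Sum>j<i. part la (Suc j))"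
    by (rule sum.reindex_bij_witness[of _ Suc "\<lambda>j. j - 1"]) auto
  then show ?thesis using sum_row_fun by (simp add: row_fun_def)
qed

lemma card_inversions_core_rows:
  assumes "0 < n" "restricted n la"
  shows "card (inversions n (beads (row_fun (core_rows n la)))) = sum_list la"
proof -
  have "\<forall>i\<ge>length la. row_fun (core_rows n la) i = 0" by (simp add: row_fun_nth)
  from card_inversions_eq_sum[OF young_shape_core_rows[OF assms] this]
  show ?thesis using card_gaps_core_rows[OF assms] by (simp add: sum_row_fun)
qed

text \<open>The recursion builds the core from the top row down, so cutting off the bottom
  \<open>m\<close> rows gives the core of the remaining parts.\<close>

lemma core_rows_drop: "core_rows n (drop m la) = drop m (core_rows n la)"
proof (induction la arbitrary: m)
  case (Cons p la)
  then show ?case by (cases m) auto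
qed simp

lemma row_fun_drop: "row_fun (drop m la) i = row_fun la (m + i)"
  by (auto simp: row_fun_nth)

lemma restricted_drop: "restricted n la \<Longrightarrow> restricted n (drop m la)"
  by (auto simp: restricted_def sorted_wrt_drop dest: in_set_dropD)

lemma entry_ge_row:
  assumes T: "T \<in> semistandard_tableaux sh" and sh: "sorted_wrt (\<ge>) sh"
    and j: "j < row_fun sh i"
  shows "i < T (Suc i, Suc j)"
  using j
proof (induction i)
  case 0
  then have "(1, Suc j) \<in> cells sh" using Suc_mem_cells_iff[of 0] by simp
  then have "T (1, Suc j) \<in> {1..}" using T unfolding semistandard_tableaux_def PiE_def by blast
  then show ?case by simp
next
  case (Suc i)
  have "antimono (row_fun sh)" using young_shape_row_fun[OF sh] by (simp add: young_shape_def)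
  then have j: "j < row_fun sh i" using Suc.prems antimonoD[of "row_fun sh" i "Suc i"] by simp
  then have "T (Suc i, Suc j) < T (Suc (Suc i), Suc j)"
    using T Suc.prems Suc_mem_cells_iff unfolding semistandard_tableaux_def by blast
  then show ?case using Suc.IH[OF j] by simp
qed

lemma sum_drop_le_residue_counts:
  assumes n: "2 \<le> n" and la: "restricted n la"
    and T: "T \<in> semistandard_tableaux (core_rows n la)"
    and N: "\<And>c. c \<in> cells (core_rows n la) \<Longrightarrow> T c \<le> N"
  shows "sum_list (drop m la) \<le>
    (\<Sum>x\<in>{m<..N}. card (residue n ` {c \<in> cells (core_rows n la). T c = x}))"
proof -
  let ?sh = "core_rows n la"
  let ?g = "\<lambda>i. row_fun ?sh (m + i)"
  let ?T = "\<lambda>(i, j). T (Suc (m + i), Suc j)"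
  let ?res = "\<lambda>(i, j). (int j - int i) mod int n"
  have n0: "0 < n" using n by simp
  have g: "row_fun (core_rows n (drop m la)) = ?g"
    by (simp add: fun_eq_iff core_rows_drop row_fun_drop)
  have la': "restricted n (drop m la)" using restricted_drop[OF la] .
  note shape = young_shape_core_rows[OF n0 la', unfolded g]
  note core = core_set_core_rows[OF n0 la', unfolded g]
  have sorted: "sorted_wrt (\<ge>) ?sh" using sorted_core_rows[OF n0 la] by simp
  have cell: "(Suc (m + i), Suc j) \<in> cells ?sh" if "j < ?g i" for i j
    using that Suc_mem_cells_iff by simp
  have low: "m < ?T (i, j)" if "j < ?g i" for i j
    using entry_ge_row[OF T sorted that] by simp
  have anti: "?g (Suc i) \<le> ?g i" for i using shape by (simp add: young_shape_def antimono_iff_le_Suc)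
  have "sum_list (drop m la) = card (inversions n (beads ?g))"
    using card_inversions_core_rows[OF n0 la'] g by simp
  also have "\<dots> \<le> (\<Sum>x<Suc N. card (?res ` {(i, j). j < ?g i \<and> ?T (i, j) = x}))"
  proof (rule card_inversions_le_residue_counts[OF n shape core])
    fix i j j' assume "j < j'" "j' < ?g i"
    then show "?T (i, j) \<le> ?T (i, j')"
      using T cell[of j i] cell[of j' i] unfolding semistandard_tableaux_def by simp
  next
    fix i j assume "j < ?g (Suc i)"
    then show "?T (i, j) < ?T (Suc i, j)"
      using T cell[of j i] cell[of j "Suc i"] anti[of i] unfolding semistandard_tableaux_def by simp
  next
    fix i j assume "j < ?g i"
    then show "?T (i, j) < Suc N" using N[OF cell] by (simp add: less_Suc_eq_le)
  qed
  also have "\<dots> = (\<Sum>x\<in>{m<..N}. card (?res ` {(i, j). j < ?g i \<and> ?T (i, j) = x}))"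
  proof (rule sum.mono_neutral_right)
    show "\<forall>x\<in>{..<Suc N} - {m<..N}. card (?res ` {(i, j). j < ?g i \<and> ?T (i, j) = x}) = 0"
    proof
      fix x assume "x \<in> {..<Suc N} - {m<..N}"
      then have "{(i, j). j < ?g i \<and> ?T (i, j) = x} = {}" using low by force
      then show "card (?res ` {(i, j). j < ?g i \<and> ?T (i, j) = x}) = 0"
        by (simp only: image_empty card.empty)
    qed
  qed auto
  also have "\<dots> \<le> (\<Sum>x\<in>{m<..N}. card (residue n ` {c \<in> cells ?sh. T c = x}))"
  proof (rule sum_mono)
    fix x
    \<comment> \<open>Renumbering the rows from \<open>m\<close> rotates all residues by
      \<open>m\<close>, which preserves the number of distinct ones.\<close>
    have "?res ` {(i, j). j < ?g i \<and> ?T (i, j) = x} \<subseteq>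
      (\<lambda>r. (r + int m) mod int n) ` residue n ` {c \<in> cells ?sh. T c = x}"
    proof
      fix r assume "r \<in> ?res ` {(i, j). j < ?g i \<and> ?T (i, j) = x}"
      then obtain i j where ij: "r = (int j - int i) mod int n" "j < ?g i" "T (Suc (m + i), Suc j) = x"
        by auto
      have "r = (residue n (Suc (m + i), Suc j) + int m) mod int n"
        unfolding ij(1) by (simp add: residue_def mod_add_left_eq)
      then show "r \<in> (\<lambda>r. (r + int m) mod int n) ` residue n ` {c \<in> cells ?sh. T c = x}"
        using cell[OF ij(2)] ij(3) by blast
    qed
    then have "card (?res ` {(i, j). j < ?g i \<and> ?T (i, j) = x}) \<le>
      card ((\<lambda>r. (r + int m) mod int n) ` residue n ` {c \<in> cells ?sh. T c = x})"
      by (rule card_mono[rotated]) (simp add: finite_cells)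
    also have "\<dots> \<le> card (residue n ` {c \<in> cells ?sh. T c = x})"
      by (rule card_image_le) (simp add: finite_cells)
    finally show "card (?res ` {(i, j). j < ?g i \<and> ?T (i, j) = x}) \<le>
      card (residue n ` {c \<in> cells ?sh. T c = x})" .
  qed
  finally show ?thesis .
qed

section \<open>Merging two adjacent parts\<close>

text \<open>In this numbering a bead stays fixed when rows are added below it, which makes cores
  with different numbers of parts comparable.\<close>

definition norm_bead :: "nat \<Rightarrow> nat list \<Rightarrow> nat \<Rightarrow> int" where
  "norm_bead n la i = bead (row_fun (core_rows n la)) i + int (length la)"

lemma norm_bead_0:
  assumes "0 < n" "restricted n (p # ps)"
  shows "norm_bead n (p # ps) 0 = core_state n ps ! p + int n"
  by (rule core_state_Cons[OF assms]) (simp add: norm_bead_def bead_def row_fun_simps)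

lemma norm_bead_Suc: "norm_bead n (p # ps) (Suc i) = norm_bead n ps i"
  by (simp add: norm_bead_def bead_def row_fun_simps)

lemma norm_bead_less:
  assumes "0 < n" "restricted n la" "i < j"
  shows "norm_bead n la j < norm_bead n la i"
  using bead_less[of "row_fun (core_rows n la)" i j] young_shape_core_rows[OF assms(1,2)] assms(3)
  by (simp add: young_shape_def norm_bead_def)

lemma range_norm_bead:
  assumes "0 < n" "restricted n la"
  shows "x \<in> range (norm_bead n la) \<longleftrightarrow> x \<in> runner_set n (core_state n la)"
proof -
  have "x \<in> range (norm_bead n la) \<longleftrightarrow> x - int (length la) \<in> beads (row_fun (core_rows n la))"
    unfolding beads_def norm_bead_def by (auto simp: image_iff) (metis add.commute diff_add_cancel)+
  then show ?thesis using beads_core_rows[OF assms] by simp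
qed

lemma between_norm_beads:
  assumes n: "0 < n" "restricted n la"
    and z: "norm_bead n la (Suc i) < z" "z < norm_bead n la i"
  shows "z \<notin> runner_set n (core_state n la)"
proof
  assume "z \<in> runner_set n (core_state n la)"
  then obtain l where l: "z = norm_bead n la l" using range_norm_bead[OF n] by blast
  consider "l \<le> i" | "Suc i \<le> l" by linarith
  then show False
    using norm_bead_less[OF n, of l i] norm_bead_less[OF n, of "Suc i" l] z l
    by cases (auto simp: le_less)
qed

text \<open>For the rotation of runners, \<open>y\<close> is at most the next place above
  \<open>x\<close> with residue in \<open>D\<close>. This much is all that interlacing requires, and
  it is invariant under adding \<open>n\<close> to both.\<close>

definition jump :: "nat \<Rightarrow> int set \<Rightarrow> int \<Rightarrow> int \<Rightarrow> bool" where
  "jump n D x y \<longleftrightarrow> x < y \<and> x mod int n \<in> D \<and> (\<forall>z. x < z \<and> z < y \<longrightarrow> z mod int n \<notin> D)"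

lemma jump_add: "jump n D x y \<Longrightarrow> jump n D (x + int n) (y + int n)"
proof -
  assume j: "jump n D x y"
  have "z mod int n \<notin> D" if "x + int n < z" "z < y + int n" for z
  proof -
    have "x < z - int n \<and> z - int n < y" using that by linarith
    then have "(z - int n) mod int n \<notin> D" using j unfolding jump_def by blast
    then show ?thesis by simp
  qed
  then show ?thesis using j by (simp add: jump_def)
qed

lemma list_all2_jump_advance:
  assumes "list_all2 (jump n D) X Y" "r < length X"
  shows "list_all2 (jump n D) (advance n X r) (advance n Y r)"
  using assms jump_add list_all2_nthD[OF assms] unfolding advance_def
  by (auto intro!: list_all2_appendI list_all2_takeI list_all2_dropI)

text \<open>For \<open>la\<close> with one part more than \<open>nu\<close>, the numberings differ
  by one: the strict inequality says that the core of \<open>nu\<close> lies inside that of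
  \<open>la\<close>, the weak one that the difference is a horizontal strip. The places strictly
  between two matching beads are the shifted contents of the strip cells of that row.\<close>

definition interlaced :: "nat \<Rightarrow> int set \<Rightarrow> nat list \<Rightarrow> nat list \<Rightarrow> bool" where
  "interlaced n D la nu \<longleftrightarrow> (\<forall>i. norm_bead n nu i < norm_bead n la i \<and>
     norm_bead n la (Suc i) \<le> norm_bead n nu i \<and>
     (\<forall>z. norm_bead n nu i < z \<and> z < norm_bead n la i \<longrightarrow> z mod int n \<notin> D))"

lemma interlaced_ConsI:
  assumes "interlaced n D la nu" "jump n D (norm_bead n (t # nu) 0) (norm_bead n (p # la) 0)"
    "norm_bead n la 0 \<le> norm_bead n (t # nu) 0"
  shows "interlaced n D (p # la) (t # nu)"
  unfolding interlaced_def
proof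
  fix i show "norm_bead n (t # nu) i < norm_bead n (p # la) i \<and>
     norm_bead n (p # la) (Suc i) \<le> norm_bead n (t # nu) i \<and>
     (\<forall>z. norm_bead n (t # nu) i < z \<and> z < norm_bead n (p # la) i \<longrightarrow> z mod int n \<notin> D)"
    using assms by (cases i) (auto simp: interlaced_def jump_def norm_bead_Suc)
qed

text \<open>
  Replacing the parts \<open>p, q\<close> by \<open>t\<close> changes the state by a cyclic rotation of the runners with
  residue in \<open>D\<close>: the next such runner takes the place of each one. Only positions from \<open>p\<close> on take
  part in later moves, they all belong to \<open>D\<close>, and moving a bead up by \<open>n\<close> commutes with the rotation.
\<close>

lemma merged_rows:
  assumes n: "0 < n" and la: "restricted n (p # q # ps)" and t: "q \<le> t" "t \<le> p"
  obtains D where "card D = (Suc t - q) + (n - Suc p)" "D \<subseteq> {0..<int n}"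
    "list_all2 (jump n D) (drop p (core_state n (t # ps))) (drop p (core_state n (p # q # ps)))"
    "interlaced n D (p # q # ps) (t # ps)"
    "jump n D (norm_bead n (t # ps) 0) (norm_bead n (p # q # ps) 0)"
proof -
  let ?S = "core_state n ps"
  have qps: "restricted n (q # ps)" and ps: "restricted n ps" and tps: "restricted n (t # ps)"
    using la t by (auto simp: restricted_Cons)
  have p: "p < n" using la by (simp add: restricted_Cons)
  have q: "q < n" and tn: "t < n" using t p by simp_all
  obtain m where S: "is_state n m ?S" and m: "m \<le> q" by (rule core_state_Cons[OF n qps])
  have len: "length ?S = n" using S by (simp add: is_state_def)
  \<comment> \<open>These are the positions whose runners move. Going from the state with
    \<open>t\<close> to the state with \<open>p\<close> and \<open>q\<close>, the entry
    \<open>q\<close> is replaced by \<open>q + 1\<close>, and so on up to \<open>t\<close>, then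
    \<open>t\<close> by \<open>p + 1\<close>, and so on, the last one by \<open>q\<close> raised by
    \<open>n\<close>. The other \<open>p + q - t\<close> runners, before \<open>q\<close> and from
    \<open>t + 1\<close> to \<open>p\<close>, stay.\<close>
  define I where "I = {q..t} \<union> {Suc p..<n}"
  define D where "D = (\<lambda>u. ?S ! u mod int n) ` I"
  have I: "u < n" "q \<le> u" if "u \<in> I" for u using that t tn p by (auto simp: I_def)
  have "inj_on (\<lambda>u. ?S ! u mod int n) I"
    by (rule inj_onI) (use is_state_inj[OF S] I in \<open>simp add: mod_eq_dvd_iff\<close>)
  then have "card D = card I" unfolding D_def by (rule card_image)
  also have "\<dots> = card {q..t} + card {Suc p..<n}"
    unfolding I_def by (rule card_Un_disjoint) (use t in auto)
  finally have card_D: "card D = (Suc t - q) + (n - Suc p)" by simp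
  have D_sub: "D \<subseteq> {0..<int n}" using n by (auto simp: D_def)
  \<comment> \<open>The state continued by one entry: position \<open>n\<close> holds the entry
    \<open>q\<close> raised by \<open>n\<close>, which closes the cycle.\<close>
  define e where "e x = (if x < n then ?S ! x else ?S ! q + int n)" for x
  have e_less: "e x < e y" if "x < y" "y \<le> n" for x y
    using that is_state_nth_less[OF S, of x y] is_state_last[OF S, of x] is_state_head[OF S q m]
    by (auto simp: e_def)
  have e_range: "?S ! q \<le> e x" "e x \<le> ?S ! q + int n" if "q \<le> x" "x \<le> n" for x
    using e_less[of q x] e_less[of x n] that q by (auto simp: e_def le_less)
  have jump_e: "jump n D (e x) (e y)" if x: "x \<in> I" and y: "x < y" "y \<le> n"
    and none: "\<And>u. x < u \<Longrightarrow> u < y \<Longrightarrow> u \<notin> I" for x y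
    unfolding jump_def
  proof (intro conjI allI impI notI)
    show "e x < e y" using e_less y by simp
    show "e x mod int n \<in> D" using x I(1)[OF x] by (simp add: e_def D_def)
    fix z assume z: "e x < z \<and> z < e y" "z mod int n \<in> D"
    then obtain u where u: "u \<in> I" "z mod int n = ?S ! u mod int n" by (auto simp: D_def)
    \<comment> \<open>All values considered lie in one window of length \<open>n\<close> starting at
      \<open>?S ! q\<close>, and \<open>e u\<close> is not its upper end; being congruent to
      \<open>z\<close>, it must equal \<open>z\<close>.\<close>
    have eu: "e u = ?S ! u" using I(1)[OF u(1)] by (simp add: e_def)
    have "e u < ?S ! q + int n" using e_less[of u n] I(1)[OF u(1)] by (simp add: e_def)
    then have "\<bar>z - ?S ! u\<bar> < int n"
      using z(1) e_range[of x] e_range[of y] e_range[of u] eu I[OF x] I[OF u(1)] y by force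
    moreover have "int n dvd z - ?S ! u" using u(2) by (simp add: mod_eq_dvd_iff)
    ultimately have "z = e u" using eu dvd_imp_le_int[of "z - ?S ! u" "int n"] by force
    then have "x < u" "u < y"
      using z(1) e_less[of u x] e_less[of y u] I(1)[OF x] I(1)[OF u(1)]
      by (metis linorder_neqE_nat order_less_asym less_imp_le order_less_irrefl)+
    then show False using none u(1) by blast
  qed
  have jump_next: "jump n D (e x) (e (Suc x))" if "p < x" "x < n" for x
    by (rule jump_e) (use that in \<open>auto simp: I_def\<close>)
  have jump_t: "jump n D (e t) (e (Suc p))"
    by (rule jump_e) (use t p in \<open>auto simp: I_def\<close>)
  have nth_q: "core_state n (q # ps) ! x = e (Suc x)" if "q \<le> x" "x < n" for x
    using that q by (simp add: nth_advance len e_def)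
  have len_q: "length (core_state n (q # ps)) = n" using q by (simp add: length_advance len)
  have len_t: "length (core_state n (t # ps)) = n" using tn by (simp add: length_advance len)
  have len_p: "length (core_state n (p # q # ps)) = n"
    using p len_q by (simp add: length_advance del: core_state.simps(2)[of n q])
  have nth_t: "core_state n (t # ps) ! x = (if Suc x < n then e (Suc x) else e t + int n)"
    if "p \<le> x" "x < n" for x
    using that t tn by (simp add: nth_advance len e_def)
  have nth_p: "core_state n (p # q # ps) ! x = (if Suc x < n then e (Suc (Suc x)) else e (Suc p) + int n)"
    if "p \<le> x" "x < n" for x
    using that p nth_q t nth_advance[of p "core_state n (q # ps)" x n] len_q by simp
  have start: "list_all2 (jump n D) (drop p (core_state n (t # ps))) (drop p (core_state n (p # q # ps)))"
  proof (rule list_all2_all_nthI)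
    show "length (drop p (core_state n (t # ps))) = length (drop p (core_state n (p # q # ps)))"
      using len_t len_p by (simp del: core_state.simps)
  next
    fix i assume "i < length (drop p (core_state n (t # ps)))"
    then have "p + i < n" using len_t by (simp del: core_state.simps)
    then show "jump n D (drop p (core_state n (t # ps)) ! i) (drop p (core_state n (p # q # ps)) ! i)"
      using nth_t[of "p + i"] nth_p[of "p + i"] jump_next[of "Suc (p + i)"] jump_add[OF jump_t]
        len_t len_p
      by (auto simp del: core_state.simps)
  qed
  have t0: "norm_bead n (t # ps) 0 = e t + int n"
    using norm_bead_0[OF n tps] tn by (simp add: e_def)
  have p0: "norm_bead n (p # q # ps) 0 = e (Suc p) + int n"
    using norm_bead_0[OF n la] nth_q[of p] t p by simp
  have q0: "norm_bead n (q # ps) 0 = e q + int n"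
    using norm_bead_0[OF n qps] q by (simp add: e_def)
  have first: "jump n D (norm_bead n (t # ps) 0) (norm_bead n (p # q # ps) 0)"
    using t0 p0 jump_add[OF jump_t] by simp
  \<comment> \<open>Adding the row of \<open>q\<close> pairs each bead with the next one. On a
    runner in \<open>D\<close> the free places start at its entry plus \<open>n\<close>, which is
    not below the bottom bead \<open>?S ! q + n\<close>; so no free place between consecutive beads
    has a residue in \<open>D\<close>.\<close>
  moreover have "interlaced n D (q # ps) ps"
    unfolding interlaced_def
  proof (intro allI conjI impI)
    fix i
    show "norm_bead n ps i < norm_bead n (q # ps) i"
      using norm_bead_less[OF n qps, of i "Suc i"] by (simp add: norm_bead_Suc)
    show "norm_bead n (q # ps) (Suc i) \<le> norm_bead n ps i" by (simp add: norm_bead_Suc)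
    fix z assume z: "norm_bead n ps i < z \<and> z < norm_bead n (q # ps) i"
    then have "z \<notin> runner_set n (core_state n (q # ps))"
      using between_norm_beads[OF n qps, of i z] by (simp add: norm_bead_Suc)
    then have z': "z \<notin> runner_set n ?S" using runner_set_advance[OF S q m] by simp
    have "norm_bead n (q # ps) i \<le> norm_bead n (q # ps) 0"
      using norm_bead_less[OF n qps, of 0 i] by (cases i) auto
    then have zq: "z < e q + int n" using z q0 by simp
    show "z mod int n \<notin> D"
    proof
      assume "z mod int n \<in> D"
      then obtain u where u: "u \<in> I" "z mod int n = ?S ! u mod int n" by (auto simp: D_def)
      then have d: "int n dvd z - ?S ! u" by (simp add: mod_eq_dvd_iff)
      then have "?S ! u < z" using runner_set_nth_iff[OF S I(1)[OF u(1)] d] z' by simp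
      then have "?S ! u + int n \<le> z" using zdvd_imp_le[OF d] by simp
      moreover have "e q \<le> e u" using e_less[of q u] I[OF u(1)] by (cases "q = u") auto
      ultimately show False using zq I(1)[OF u(1)] by (simp add: e_def)
    qed
  qed
  moreover have "norm_bead n (q # ps) 0 \<le> norm_bead n (t # ps) 0"
    using q0 t0 e_less[of q t] t tn by (cases "q = t") auto
  ultimately have "interlaced n D (p # q # ps) (t # ps)" using interlaced_ConsI first by blast
  then show ?thesis using that card_D D_sub start first by blast
qed

lemma merged_rows_append:
  assumes n: "0 < n" and la: "restricted n (pre @ p # q # ps)" and t: "q \<le> t" "t \<le> p"
    and start: "list_all2 (jump n D) (drop p (core_state n (t # ps))) (drop p (core_state n (p # q # ps)))"
    "interlaced n D (p # q # ps) (t # ps)"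
    "jump n D (norm_bead n (t # ps) 0) (norm_bead n (p # q # ps) 0)"
  shows "list_all2 (jump n D) (drop p (core_state n (pre @ t # ps)))
      (drop p (core_state n (pre @ p # q # ps))) \<and>
    interlaced n D (pre @ p # q # ps) (pre @ t # ps) \<and>
    jump n D (norm_bead n (pre @ t # ps) 0) (norm_bead n (pre @ p # q # ps) 0)"
  using la
proof (induction pre)
  case (Cons r pre)
  let ?la = "pre @ p # q # ps" and ?nu = "pre @ t # ps"
  have rla: "restricted n (r # ?la)" using Cons.prems by simp
  then have la: "restricted n ?la" and r: "p \<le> r" "r < n" by (auto simp: restricted_Cons)
  have rnu: "restricted n (r # ?nu)"
    using rla t by (fastforce simp: restricted_def sorted_wrt_append)
  then have nu: "restricted n ?nu" by (simp add: restricted_Cons)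
  have IH: "list_all2 (jump n D) (drop p (core_state n ?nu)) (drop p (core_state n ?la))"
    "interlaced n D ?la ?nu" "jump n D (norm_bead n ?nu 0) (norm_bead n ?la 0)"
    using Cons.IH[OF la] by auto
  have len: "length (core_state n ?la) = n" "length (core_state n ?nu) = n"
    using is_state_core_state[OF n la] is_state_core_state[OF n nu] by (auto simp: is_state_def)
  have "list_all2 (jump n D) (drop p (core_state n (r # ?nu))) (drop p (core_state n (r # ?la)))"
    using list_all2_jump_advance[OF IH(1), of "r - p"] r len by (simp add: drop_advance)
  moreover have "jump n D (core_state n ?nu ! r) (core_state n ?la ! r)"
    using list_all2_nthD[OF IH(1), of "r - p"] r len by simp
  then have j: "jump n D (norm_bead n (r # ?nu) 0) (norm_bead n (r # ?la) 0)"
    using jump_add norm_bead_0[OF n rla] norm_bead_0[OF n rnu] by simp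
  \<comment> \<open>If this failed, the new bead of \<open>r # ?nu\<close> would lie strictly inside
    the previous jump and avoid \<open>D\<close>; but as the start of a jump it has its residue in
    \<open>D\<close>.\<close>
  moreover have "norm_bead n ?la 0 \<le> norm_bead n (r # ?nu) 0"
  proof (rule ccontr)
    assume "\<not> norm_bead n ?la 0 \<le> norm_bead n (r # ?nu) 0"
    moreover have "norm_bead n ?nu 0 < norm_bead n (r # ?nu) 0"
      using norm_bead_less[OF n rnu, of 0 1] norm_bead_Suc[of n r ?nu 0] by simp
    ultimately have "norm_bead n (r # ?nu) 0 mod int n \<notin> D" using IH(3) by (simp add: jump_def)
    then show False using j by (simp add: jump_def)
  qed
  ultimately show ?case using interlaced_ConsI[OF IH(2) j] by simp
qed (use start in simp)

text \<open>Only an upper bound on the number of residues is demanded; the exact value follows later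
  from counting inversions.\<close>

definition weak_strip :: "nat \<Rightarrow> nat list \<Rightarrow> nat list \<Rightarrow> nat \<Rightarrow> bool" where
  "weak_strip n la nu m \<longleftrightarrow> (let g = row_fun (core_rows n la); h = row_fun (core_rows n nu) in
     (\<forall>i. h i \<le> g i \<and> g (Suc i) \<le> h i) \<and>
     card ((\<lambda>(i, j). (int j - int i) mod int n) ` {(i, j). h i \<le> j \<and> j < g i}) \<le> m)"

lemma weak_strip_merge:
  assumes n: "0 < n" and la: "restricted n (pre @ p # q # ps)" and t: "q \<le> t" "t \<le> p"
  shows "weak_strip n (pre @ p # q # ps) (pre @ t # ps) (p + q - t)"
proof -
  let ?la = "pre @ p # q # ps" and ?nu = "pre @ t # ps"
  let ?g = "row_fun (core_rows n ?la)" and ?h = "row_fun (core_rows n ?nu)"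
  have pqps: "restricted n (p # q # ps)" using la by (auto simp: restricted_def sorted_wrt_append)
  then have p: "p < n" by (simp add: restricted_Cons)
  obtain D where D: "card D = (Suc t - q) + (n - Suc p)" "D \<subseteq> {0..<int n}"
    and "list_all2 (jump n D) (drop p (core_state n (t # ps))) (drop p (core_state n (p # q # ps)))"
      "interlaced n D (p # q # ps) (t # ps)"
      "jump n D (norm_bead n (t # ps) 0) (norm_bead n (p # q # ps) 0)"
    by (rule merged_rows[OF n pqps t])
  from merged_rows_append[OF n la t this(3-5)] have inter: "interlaced n D ?la ?nu" by blast
  have nested: "?h i \<le> ?g i \<and> ?g (Suc i) \<le> ?h i" for i
    using inter[unfolded interlaced_def, rule_format, of i] by (simp add: norm_bead_def bead_def)
  \<comment> \<open>The number of parts of \<open>?nu\<close>, which turns contents of cells into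
    normalized places.\<close>
  define L where "L = int (length pre + length ps + 1)"
  let ?R = "(\<lambda>(i, j). (int j - int i) mod int n) ` {(i, j). ?h i \<le> j \<and> j < ?g i}"
  have "?R \<subseteq> (\<lambda>r. (r - L) mod int n) ` ({0..<int n} - D)"
  proof
    fix r assume "r \<in> ?R"
    then obtain i j where ij: "r = (int j - int i) mod int n" "?h i \<le> j" "j < ?g i" by auto
    define z where "z = int j - int i + L"
    have "norm_bead n ?nu i < z" "z < norm_bead n ?la i"
      using ij by (simp_all add: z_def norm_bead_def bead_def L_def)
    then have "z mod int n \<notin> D" using inter by (simp add: interlaced_def)
    moreover have "r = (z mod int n - L) mod int n"
      unfolding ij(1) z_def by (simp add: mod_diff_left_eq)
    ultimately show "r \<in> (\<lambda>r. (r - L) mod int n) ` ({0..<int n} - D)" using n by force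
  qed
  then have "card ?R \<le> card ({0..<int n} - D)"
    by (meson card_image_le card_mono finite_Diff finite_atLeastLessThan_int finite_imageI le_trans)
  also have "\<dots> = n - card D" using D by (simp add: card_Diff_subset finite_subset)
  also have "\<dots> \<le> p + q - t" using D(1) t p by simp
  finally show ?thesis using nested by (simp add: weak_strip_def)
qed

section \<open>Existence of tableaux\<close>

lemma split_around:
  assumes "2 \<le> length la" "last la \<le> m" "m \<le> hd la"
  obtains pre p q ps where "la = pre @ p # q # ps" "q \<le> m" "m \<le> (p :: nat)"
proof -
  have "\<exists>pre p q ps. la = pre @ p # q # ps \<and> q \<le> m \<and> m \<le> p"
    using assms
  proof (induction la)
    case (Cons p la)
    then obtain q ps where la: "la = q # ps" by (cases la) auto
    show ?case
    proof (cases "q \<le> m")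
      case True
      then show ?thesis using Cons.prems la by (intro exI[of _ "[]"]) auto
    next
      case False
      then have "2 \<le> length la" using Cons.prems la by (cases ps) auto
      then obtain pre p' q' ps' where "la = pre @ p' # q' # ps' \<and> q' \<le> m \<and> m \<le> p'"
        using Cons.IH Cons.prems la False by auto
      then show ?thesis by (intro exI[of _ "p # pre"]) auto
    qed
  qed simp
  then show ?thesis using that by blast
qed

text \<open>Cells are counted from 0, letters from 1. As \<open>part mu 0 = 0\<close>, the last
  clause also covers the letter 0.\<close>

definition strip_tableau :: "nat \<Rightarrow> nat list \<Rightarrow> nat list \<Rightarrow> (nat \<times> nat \<Rightarrow> nat) \<Rightarrow> bool" where
  "strip_tableau n la mu T \<longleftrightarrow> (let g = row_fun (core_rows n la) in
     (\<forall>i j j'. j < j' \<and> j' < g i \<longrightarrow> T (i, j) \<le> T (i, j')) \<and>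
     (\<forall>i j. j < g (Suc i) \<longrightarrow> T (i, j) < T (Suc i, j)) \<and>
     (\<forall>i j. j < g i \<longrightarrow> 1 \<le> T (i, j) \<and> T (i, j) \<le> length mu) \<and>
     (\<forall>x. card ((\<lambda>(i, j). (int j - int i) mod int n) ` {(i, j). j < g i \<and> T (i, j) = x}) \<le> part mu x))"

lemma strip_tableau_snoc:
  assumes n: "0 < n" and la: "restricted n la" and nu: "restricted n nu"
    and strip: "weak_strip n la nu m" and T: "strip_tableau n nu mu T"
  shows "strip_tableau n la (mu @ [m])
    (\<lambda>(i, j). if j < row_fun (core_rows n nu) i then T (i, j) else Suc (length mu))"
proof -
  let ?g = "row_fun (core_rows n la)" and ?h = "row_fun (core_rows n nu)"
  let ?T = "\<lambda>(i, j). if j < ?h i then T (i, j) else Suc (length mu)"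
  let ?res = "\<lambda>(i, j). (int j - int i) mod int n"
  have nested: "?h i \<le> ?g i" "?g (Suc i) \<le> ?h i" for i
    using strip by (auto simp: weak_strip_def Let_def)
  have row: "T (i, j) \<le> T (i, j')" if "j < j'" "j' < ?h i" for i j j'
    using T that by (auto simp: strip_tableau_def Let_def)
  have col: "T (i, j) < T (Suc i, j)" if "j < ?h (Suc i)" for i j
    using T that by (auto simp: strip_tableau_def Let_def)
  have range: "1 \<le> T (i, j)" "T (i, j) \<le> length mu" if "j < ?h i" for i j
    using T that by (auto simp: strip_tableau_def Let_def)
  have cd: "card (?res ` {(i, j). j < ?h i \<and> T (i, j) = x}) \<le> part mu x" for x
    using T by (simp add: strip_tableau_def Let_def)
  have cd': "card (?res ` {(i, j). ?h i \<le> j \<and> j < ?g i}) \<le> m"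
    using strip by (simp add: weak_strip_def Let_def)
  have "card (?res ` {(i, j). j < ?g i \<and> ?T (i, j) = x}) \<le> part (mu @ [m]) x" for x
  proof (cases "x = Suc (length mu)")
    case True
    have "T (i, j) \<noteq> Suc (length mu)" if "j < ?h i" for i j using range(2)[OF that] by simp
    then have "{(i, j). j < ?g i \<and> ?T (i, j) = x} = {(i, j). ?h i \<le> j \<and> j < ?g i}"
      using True by (auto split: if_splits)
    moreover have "part (mu @ [m]) x = m" using True by (simp add: part_def)
    ultimately show ?thesis using cd' by (simp only:)
  next
    case False
    then have "{(i, j). j < ?g i \<and> ?T (i, j) = x} = {(i, j). j < ?h i \<and> T (i, j) = x}"
      using nested(1) by (auto intro: less_le_trans)
    moreover have "part mu x \<le> part (mu @ [m]) x" by (auto simp: part_def nth_append)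
    ultimately show ?thesis using cd[of x] by (metis (no_types, lifting) le_trans)
  qed
  moreover have "?T (i, j) \<le> ?T (i, j')" if "j < j'" "j' < ?g i" for i j j'
    using row[OF that(1)] range(2)[of j i] that by (auto intro: le_SucI)
  moreover have "?T (i, j) < ?T (Suc i, j)" if "j < ?g (Suc i)" for i j
    using col[of j i] range(2)[of j i] nested(2)[of i] that by auto
  moreover have "1 \<le> ?T (i, j)" "?T (i, j) \<le> length (mu @ [m])" for i j
    using range[of j i] by auto
  ultimately show ?thesis unfolding strip_tableau_def Let_def by blast
qed

text \<open>The last letter to be removed: with a single part left there is no pair to
  merge.\<close>

lemma weak_strip_single_row:
  assumes "m < n" shows "weak_strip n [m] [] m"
proof -
  have row: "row_fun (core_rows n [m]) i = (if i = 0 then m else 0)" for i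
    using assms by (cases i) (simp_all add: row_fun_simps nth_upto)
  have row0: "row_fun (core_rows n []) i = 0" for i by (simp add: row_fun_simps)
  have "{(i, j). row_fun (core_rows n []) i \<le> j \<and> j < row_fun (core_rows n [m]) i} = Pair 0 ` {..<m}"
    by (auto simp: row row0 simp del: core_rows.simps split: if_splits)
  then have "card ((\<lambda>(i, j). (int j - int i) mod int n) `
      {(i, j). row_fun (core_rows n []) i \<le> j \<and> j < row_fun (core_rows n [m]) i}) \<le> m"
    by (metis (no_types, lifting) card_image_le card_lessThan finite_imageI finite_lessThan le_trans)
  then show ?thesis unfolding weak_strip_def Let_def by (auto simp: row row0 simp del: core_rows.simps)
qed

text \<open>Equal lengths and equal sums turn dominance one step before the end into
  \<open>last la \<le> m\<close>, while dominance at the first part gives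
  \<open>m \<le> hd la\<close>. The cells removed by the merge receive the letter of the last part
  of \<open>mu\<close>.\<close>

lemma strip_tableau_exists:
  assumes n: "0 < n" and "restricted n la" "restricted n mu" "length la = length mu"
    "sum_list la = sum_list mu"
    "\<forall>i\<le>length mu. sum_list (take i mu) \<le> sum_list (take i la)"
  shows "\<exists>T. strip_tableau n la mu T"
  using assms(2-)
proof (induction mu arbitrary: la rule: rev_induct)
  case Nil
  then show ?case by (auto simp: strip_tableau_def row_fun_simps)
next
  case (snoc m mu)
  have mu: "restricted n mu" and mn: "m < n" and small: "\<forall>x\<in>set mu. m \<le> x"
    using snoc.prems(2) by (auto simp: restricted_def sorted_wrt_append)
  have "\<exists>nu. restricted n nu \<and> length nu = length mu \<and> sum_list nu = sum_list mu \<and>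
    (\<forall>i\<le>length mu. sum_list (take i mu) \<le> sum_list (take i nu)) \<and> weak_strip n la nu m"
  proof (cases "mu = []")
    case True
    then have "la = [m]" using snoc.prems by (cases la) auto
    then show ?thesis using True weak_strip_single_row[OF mn]
      by (intro exI[of _ "[]"]) (simp add: restricted_def)
  next
    case False
    have len: "length la = Suc (length mu)" using snoc.prems by simp
    then have "la \<noteq> []" by auto
    have "sum_list la = sum_list (butlast la) + last la"
      using append_butlast_last_id[OF \<open>la \<noteq> []\<close>] by (metis sum_list.append sum_list.Cons sum_list.Nil add_0_right)
    moreover have "butlast la = take (length mu) la" using len by (simp add: butlast_conv_take)
    moreover have "sum_list mu \<le> sum_list (take (length mu) la)"
      using snoc.prems(5)[rule_format, of "length mu"] by simp
    ultimately have last: "last la \<le> m" using snoc.prems(4) by simp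
    have "hd mu \<le> hd la"
      using snoc.prems(5)[rule_format, of 1] False \<open>la \<noteq> []\<close> by (cases mu; cases la) auto
    moreover have "m \<le> hd mu" using small False by simp
    ultimately have hd: "m \<le> hd la" by simp
    have "2 \<le> length la" using len False by (cases mu) auto
    then obtain pre p q ps where la: "la = pre @ p # q # ps" and q: "q \<le> m" and p: "m \<le> p"
      using split_around last hd by blast
    define t where "t = p + q - m"
    have t: "q \<le> t" "t \<le> p" "p + q - t = m" "t + m = p + q" using p q by (auto simp: t_def)
    let ?nu = "pre @ t # ps"
    have "restricted n ?nu"
      using snoc.prems(1) t unfolding la by (fastforce simp: restricted_def sorted_wrt_append)
    moreover have "weak_strip n la ?nu m"
      using weak_strip_merge[OF n snoc.prems(1)[unfolded la] t(1,2)] t(3) la by simp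
    moreover have nu_len: "length ?nu = length mu" using len la by simp
    moreover have sum: "sum_list ?nu = sum_list mu" using snoc.prems(4) la t(4) by simp
    moreover have "sum_list (take i mu) \<le> sum_list (take i ?nu)" if i: "i \<le> length mu" for i
    proof (cases "i \<le> length pre")
      case True
      then have "take i ?nu = take i la" using la by simp
      then show ?thesis using snoc.prems(5)[rule_format, of i] i by simp
    next
      case False
      then obtain j where j: "i = length pre + Suc j" by (metis add_Suc_right less_imp_Suc_add not_le)
      \<comment> \<open>Beyond the merged part, an initial sum of \<open>?nu\<close> is the next
        longer one of \<open>la\<close> reduced by \<open>m\<close>. The corresponding sum of
        \<open>mu\<close> shrinks by an entry that is at least \<open>m\<close>, so dominance
        survives.\<close>
      have "sum_list (take i ?nu) + m = sum_list (take (Suc i) la)"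
        using t(4) by (simp add: la j)
      also have "\<dots> \<ge> sum_list (take (Suc i) (mu @ [m]))"
        using snoc.prems(5)[rule_format, of "Suc i"] i by simp
      finally have "sum_list (take (Suc i) (mu @ [m])) \<le> sum_list (take i ?nu) + m" .
      moreover have "sum_list (take (Suc i) (mu @ [m])) = sum_list (take i mu) + (mu @ [m]) ! i"
        using take_Suc_conv_app_nth[of i "mu @ [m]"] i take_append[of i mu "[m]"]
        by (simp del: take_append)
      moreover have "m \<le> (mu @ [m]) ! i" using small i by (simp add: nth_append)
      ultimately show ?thesis by linarith
    qed
    ultimately show ?thesis by blast
  qed
  then obtain nu where nu: "restricted n nu" "length nu = length mu" "sum_list nu = sum_list mu"
    "\<forall>i\<le>length mu. sum_list (take i mu) \<le> sum_list (take i nu)" "weak_strip n la nu m" by blast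
  then obtain T where "strip_tableau n nu mu T" using snoc.IH[OF nu(1) mu nu(2-4)] by blast
  from strip_tableau_snoc[OF n snoc.prems(1) nu(1,5) this] show ?case by blast
qed

section \<open>Padding by zeros, and the passage to \<open>k_tableaux\<close>\<close>

lemma row_fun_append_zeros: "row_fun (la @ replicate z 0) = row_fun la"
  by (auto simp: fun_eq_iff row_fun_nth nth_append)

lemma restricted_append_zeros:
  assumes "0 < n" "restricted n la" shows "restricted n (la @ replicate z 0)"
proof -
  have "sorted_wrt (\<ge>) (replicate z (0 :: nat))" by (induction z) auto
  then show ?thesis using assms by (auto simp: restricted_def sorted_wrt_append)
qed

text \<open>Both are cores with the same numbers of small cells in all rows, so uniqueness
  applies.\<close>

lemma row_fun_core_rows_zeros:
  assumes "2 \<le> n" "restricted n la"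
  shows "row_fun (core_rows n (la @ replicate z 0)) = row_fun (core_rows n la)"
proof -
  have n: "0 < n" using assms by simp
  have la': "restricted n (la @ replicate z 0)"
    using restricted_append_zeros[OF n assms(2)] .
  show ?thesis
    by (rule core_rows_unique[OF assms(1,2) young_shape_core_rows[OF n la'] core_set_core_rows[OF n la']])
      (simp add: card_gaps_core_rows[OF n la'] row_fun_append_zeros)
qed

lemma sum_lessThan_Suc_part:
  assumes "length mu \<le> N" shows "(\<Sum>x<Suc N. part mu x) = sum_list mu"
proof -
  have "(\<Sum>x<Suc N. part mu x) = part mu 0 + (\<Sum>x<N. row_fun mu x)"
    by (simp add: sum.lessThan_Suc_shift row_fun_def del: sum.lessThan_Suc)
  then show ?thesis using assms by (simp add: sum_row_fun part_def)
qed

lemma strip_tableau_imp_k_tableaux: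
  assumes k: "0 < k" and la: "is_partition la" "k_bounded k la"
    and sum: "sum_list la = sum_list mu"
    and T: "strip_tableau (k + 1) (la @ replicate z 0) mu T"
  shows "k_tableaux k la mu \<noteq> {}"
proof -
  let ?n = "k + 1" and ?sh = "core_rows (k + 1) la"
  let ?g = "row_fun ?sh"
  let ?res = "\<lambda>(i, j). (int j - int i) mod int ?n"
  have n: "0 < ?n" "2 \<le> ?n" using k by auto
  have r: "restricted ?n la"
    using la by (auto simp: restricted_def is_partition_def k_bounded_def less_Suc_eq_le)
  have shape: "young_shape ?g" using young_shape_core_rows[OF n(1) r] .
  have g: "row_fun (core_rows ?n (la @ replicate z 0)) = ?g"
    using row_fun_core_rows_zeros[OF n(2) r] .
  note T' = T[unfolded strip_tableau_def Let_def g]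
  have row: "T (i, j) \<le> T (i, j')" if "j < j'" "j' < ?g i" for i j j' using T' that by blast
  have col: "T (i, j) < T (Suc i, j)" if "j < ?g (Suc i)" for i j using T' that by blast
  have range: "1 \<le> T (i, j)" "T (i, j) \<le> length mu" if "j < ?g i" for i j using T' that by blast+
  let ?c = "\<lambda>x. card (?res ` {(i, j). j < ?g i \<and> T (i, j) = x})"
  have cd: "?c x \<le> part mu x" for x using T' by blast
  have "sum_list la \<le> (\<Sum>x<Suc (length mu). ?c x)"
    using card_inversions_le_residue_counts[OF n(2) shape core_set_core_rows[OF n(1) r], of T "Suc (length mu)"]
      row col range card_inversions_core_rows[OF n(1) r] by (simp add: less_Suc_eq_le)
  moreover have "(\<Sum>x<Suc (length mu). ?c x) \<le> (\<Sum>x<Suc (length mu). part mu x)"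
    by (rule sum_mono) (rule cd)
  ultimately have eq: "(\<Sum>x<Suc (length mu). ?c x) = (\<Sum>x<Suc (length mu). part mu x)"
    using sum sum_lessThan_Suc_part[of mu "length mu"] by linarith
  have cd_eq: "?c x = part mu x" for x
  proof (cases "x < Suc (length mu)")
    case True
    then show ?thesis using sum_mono_inv[OF eq cd, of x] by simp
  next
    case False
    then have "part mu x = 0" by (simp add: part_def)
    then show ?thesis using cd[of x] by simp
  qed
  define T1 where "T1 c = (if c \<in> cells ?sh then T (fst c - 1, snd c - 1) else undefined)" for c
  have T1: "T1 (Suc i, Suc j) = T (i, j)" if "j < ?g i" for i j
    using that Suc_mem_cells_iff by (simp add: T1_def)
  have cellE: "\<exists>i' j'. i = Suc i' \<and> j = Suc j' \<and> j' < ?g i'" if "(i, j) \<in> cells ?sh" for i j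
    using that Suc_mem_cells_iff by (cases i; cases j) (auto simp: mem_cells_iff)
  have col': "T (i, j) < T (i', j)" if "i < i'" "j < ?g i'" for i i' j
    using that
  proof (induction i')
    case (Suc i')
    have "?g (Suc i') \<le> ?g i'" using shape by (simp add: young_shape_def antimono_iff_le_Suc)
    then have "j < ?g i'" using Suc.prems by simp
    then show ?case using Suc.IH Suc.prems col[of j i'] by (cases "i = i'") (auto intro: less_trans)
  qed simp
  have "T1 \<in> semistandard_tableaux ?sh"
    unfolding semistandard_tableaux_def
  proof (intro CollectI conjI allI impI)
    show "T1 \<in> cells ?sh \<rightarrow>\<^sub>E {1..}"
    proof (rule PiE_I)
      fix c assume "c \<in> cells ?sh"
      then obtain i j where "c = (Suc i, Suc j)" "j < ?g i" using cellE by (cases c) blast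
      then show "T1 c \<in> {1..}" using T1 range(1) by simp
    qed (simp add: T1_def)
  next
    fix i j j' assume "(i, j) \<in> cells ?sh \<and> (i, j') \<in> cells ?sh \<and> j < j'"
    then show "T1 (i, j) \<le> T1 (i, j')" using cellE[of i j] cellE[of i j'] T1 row by auto
  next
    fix i i' j assume "(i, j) \<in> cells ?sh \<and> (i', j) \<in> cells ?sh \<and> i < i'"
    then show "T1 (i, j) < T1 (i', j)" using cellE[of i j] cellE[of i' j] T1 col' by auto
  qed
  moreover have "card (residue ?n ` {c \<in> cells ?sh. T1 c = x}) = part mu x" for x
  proof -
    have "{c \<in> cells ?sh. T1 c = x} = (\<lambda>(i, j). (Suc i, Suc j)) ` {(i, j). j < ?g i \<and> T (i, j) = x}"
    proof (intro set_eqI iffI)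
      fix c assume c: "c \<in> {c \<in> cells ?sh. T1 c = x}"
      then obtain i j where "c = (Suc i, Suc j)" "j < ?g i" using cellE by (cases c) blast
      then show "c \<in> (\<lambda>(i, j). (Suc i, Suc j)) ` {(i, j). j < ?g i \<and> T (i, j) = x}"
        using c T1 by force
    next
      fix c assume "c \<in> (\<lambda>(i, j). (Suc i, Suc j)) ` {(i, j). j < ?g i \<and> T (i, j) = x}"
      then show "c \<in> {c \<in> cells ?sh. T1 c = x}" using T1 Suc_mem_cells_iff by auto
    qed
    moreover have "residue ?n ` (\<lambda>(i, j). (Suc i, Suc j)) ` X = ?res ` X" for X
      unfolding image_image by (intro image_cong) (auto simp: residue_def)
    ultimately show ?thesis using cd_eq by simp
  qed
  ultimately have "T1 \<in> k_tableaux k la mu"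
    unfolding k_tableaux_def core_of_eq_core_rows[OF k la] by simp
  then show ?thesis by blast
qed

lemma k_tableaux_imp_dominated_by:
  assumes k: "0 < k" and la: "is_partition la" "k_bounded k la"
    and sum: "sum_list la = sum_list mu" and T: "T \<in> k_tableaux k la mu"
  shows "dominated_by mu la"
  unfolding dominated_by_def
proof
  fix i
  let ?n = "k + 1" and ?sh = "core_rows (k + 1) la"
  have r: "restricted ?n la"
    using la by (auto simp: restricted_def is_partition_def k_bounded_def less_Suc_eq_le)
  have T': "T \<in> semistandard_tableaux ?sh"
    "\<And>x. 1 \<le> x \<Longrightarrow> card (residue ?n ` {c \<in> cells ?sh. T c = x}) = part mu x"
    using T unfolding k_tableaux_def core_of_eq_core_rows[OF k la] by auto
  \<comment> \<open>Large enough to bound all entries, to reach \<open>i\<close>, and to include all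
    parts of \<open>mu\<close>.\<close>
  define N where "N = Max (insert 0 (T ` cells ?sh)) + i + length mu"
  have "T c \<le> N" if "c \<in> cells ?sh" for c
  proof -
    have "T c \<le> Max (insert 0 (T ` cells ?sh))" using that finite_cells by (intro Max_ge) auto
    then show ?thesis by (simp add: N_def)
  qed
  then have "sum_list (drop i la) \<le> (\<Sum>x\<in>{i<..N}. card (residue ?n ` {c \<in> cells ?sh. T c = x}))"
    by (intro sum_drop_le_residue_counts[OF _ r T'(1)]) (use k in auto)
  also have "\<dots> = (\<Sum>x\<in>{i<..N}. part mu x)" by (intro sum.cong T'(2)) auto
  finally have drop: "sum_list (drop i la) \<le> (\<Sum>x\<in>{i<..N}. part mu x)" .
  have "sum_list mu = (\<Sum>x = 1..N. part mu x)" unfolding sum_part by (simp add: N_def)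
  also have "{1..N} = {1..i} \<union> {i<..N}" by (auto simp: N_def)
  also have "(\<Sum>x\<in>{1..i} \<union> {i<..N}. part mu x) = (\<Sum>x = 1..i. part mu x) + (\<Sum>x\<in>{i<..N}. part mu x)"
    by (rule sum.union_disjoint) auto
  finally have "(\<Sum>x = 1..i. part mu x) + sum_list (drop i la) \<le> sum_list la" using drop sum by simp
  also have "\<dots> = sum_list (take i la) + sum_list (drop i la)"
    by (metis append_take_drop_id sum_list.append)
  finally show "(\<Sum>j = 1..i. part mu j) \<le> (\<Sum>j = 1..i. part la j)" unfolding sum_part by simp
qed

theorem theorem3p6:
  fixes k d :: nat and la mu :: "nat list"
  assumes "0 < k" and "0 < d"
    and "is_partition_of d la" and "k_bounded k la"
    and "is_partition_of d mu" and "k_bounded k mu"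
  shows "k_Kostka k la mu \<noteq> 0 \<longleftrightarrow> dominated_by mu la"
proof -
  have la: "is_partition la" "sum_list la = d" and mu: "is_partition mu" "sum_list mu = d"
    using assms by (auto simp: is_partition_of_def)
  have "k_tableaux k la mu \<noteq> {}" if dom: "dominated_by mu la"
  proof -
    have dom: "sum_list (take i mu) \<le> sum_list (take i la)" for i
      using dom unfolding dominated_by_def sum_part by blast
    \<comment> \<open>A further positive part of \<open>la\<close> would make its total exceed that
      of \<open>mu\<close>, which is already reached after \<open>length mu\<close> parts.\<close>
    have len: "length la \<le> length mu"
    proof (rule ccontr)
      assume "\<not> length la \<le> length mu"
      then obtain x xs where x: "drop (length mu) la = x # xs" by (cases "drop (length mu) la") auto
      then have "x \<in> set la" by (metis in_set_dropD list.set_intros(1))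
      then have "0 < sum_list (drop (length mu) la)" using la(1) x by (simp add: is_partition_def)
      moreover have "sum_list la = sum_list (take (length mu) la) + sum_list (drop (length mu) la)"
        by (metis append_take_drop_id sum_list.append)
      moreover have "sum_list mu \<le> sum_list (take (length mu) la)"
        using dom[of "length mu"] by simp
      ultimately show False using la(2) mu(2) by linarith
    qed
    \<comment> \<open>Padding makes the lengths agree, so that each letter of \<open>mu\<close> can
      be matched with the loss of one part.\<close>
    define z where "z = length mu - length la"
    let ?la = "la @ replicate z 0"
    have "restricted (k + 1) la"
      using la assms(4) by (auto simp: restricted_def is_partition_def k_bounded_def less_Suc_eq_le)
    then have rla: "restricted (k + 1) ?la" using restricted_append_zeros by simp
    have rmu: "restricted (k + 1) mu"
      using mu assms(6) by (auto simp: restricted_def is_partition_def k_bounded_def less_Suc_eq_le)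
    have dom': "\<forall>i\<le>length mu. sum_list (take i mu) \<le> sum_list (take i ?la)"
      using dom by (simp add: trans_le_add1)
    have len': "length ?la = length mu" using len by (simp add: z_def)
    have sum': "sum_list ?la = sum_list mu" using la mu by (simp add: sum_list_replicate)
    have "\<exists>T. strip_tableau (k + 1) ?la mu T"
      by (rule strip_tableau_exists[OF _ rla rmu len' sum' dom']) simp
    then obtain T where "strip_tableau (k + 1) ?la mu T" by blast
    then show ?thesis using strip_tableau_imp_k_tableaux[OF assms(1) la(1) assms(4)] la mu by simp
  qed
  moreover have "dominated_by mu la" if "k_tableaux k la mu \<noteq> {}"
    using that k_tableaux_imp_dominated_by[OF assms(1) la(1) assms(4)] la mu by auto
  moreover have "k_Kostka k la mu \<noteq> 0 \<longleftrightarrow> k_tableaux k la mu \<noteq> {}"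
    by (simp add: k_Kostka_def finite_k_tableaux)
  ultimately show ?thesis by blast
qed

end
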